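(* Let $A$ be a $*$-semiprime non-commutative associative algebra over $\Phi$ with involution $*$, such that $\deg(A/I)>2$ for every $*$-prime ideal $I$ of $A$. Then: (i) $\mathrm{SDer}(A)/I_{K,Z}$ is a strongly non-degenerate Lie algebra; (ii) if $Z(K)$ contains no non-zero associative $*$-ideals of $A$ (in particular, if $A$ is $*$-prime), then $\mathrm{SDer}(A)$ is a strongly non-degenerate Lie algebra.
   Context: $\Phi$ is a unital commutative ring in which $2$ and $3$ are invertible. $K=\{x\in A: x^*=-x\}$ is the Lie algebra of skew elements, $Z(K)$ its Lie center, $Z$ the center of $A$. $\mathrm{SDer}(A)=\{\delta\in\mathrm{Der}(A): \delta(x^* )=\delta(x)^*\ \forall x\in A\}$, a Lie subalgebra (under the commutator) of the Lie algebra $\mathrm{Der}(A)$ of associative derivations of $A$. $I_{K,Z}=\{\delta\in\mathrm{SDer}(A): \delta(K)\subseteq Z\}$. A $*$-ideal is an ideal $I$ with $I^*=I$; $A$ is $*$-prime ($*$-semiprime) if the product of any two non-zero $*$-ideals is non-zero (resp. $J^2\ne0$ for every non-zero $*$-ideal $J$); a $*$-ideal $I$ is $*$-prime if $A/I$ is $*$-prime. For a semiprime algebra $B$, its extended centroid $\mathcal C$ is the center of its two-sided (symmetric) ring of quotients; $\deg(x)$ is the degree of algebraicity of $x\in B$ over $\mathcal C$ ($\infty$ if not algebraic), and $\deg(B)=\sup_{x\in B}\deg(x)$. A Lie algebra $M$ is strongly non-degenerate if $[x,[x,M]]=0$ implies $x=0$. *)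

theory Defs
  imports Main "HOL-Library.Extended_Nat"
begin

definition algebra_ax :: "('r::comm_ring_1 \<Rightarrow> 'a::ring \<Rightarrow> 'a) \<Rightarrow> bool" where
  "algebra_ax sm \<longleftrightarrow>
     (\<forall>r a b. sm r (a + b) = sm r a + sm r b) \<and>
     (\<forall>r s a. sm (r + s) a = sm r a + sm s a) \<and>
     (\<forall>r s a. sm (r * s) a = sm r (sm s a)) \<and>
     (\<forall>a. sm 1 a = a) \<and>
     (\<forall>r a b. sm r (a * b) = sm r a * b \<and> sm r (a * b) = a * sm r b)"

definition involution :: "('r::comm_ring_1 \<Rightarrow> 'a::ring \<Rightarrow> 'a) \<Rightarrow> ('a \<Rightarrow> 'a) \<Rightarrow> bool" where
  "involution sm star \<longleftrightarrow>
     (\<forall>a b. star (a + b) = star a + star b) \<and>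
     (\<forall>a b. star (a * b) = star b * star a) \<and>
     (\<forall>a. star (star a) = a) \<and>
     (\<forall>r a. star (sm r a) = sm r (star a))"

definition ring_ideal :: "'a::ring set \<Rightarrow> bool" where
  "ring_ideal J \<longleftrightarrow> 0 \<in> J \<and> (\<forall>a\<in>J. \<forall>b\<in>J. a + b \<in> J) \<and> (\<forall>a\<in>J. - a \<in> J) \<and>
     (\<forall>a\<in>J. \<forall>r. r * a \<in> J \<and> a * r \<in> J)"

definition alg_ideal :: "('r::comm_ring_1 \<Rightarrow> 'a::ring \<Rightarrow> 'a) \<Rightarrow> 'a set \<Rightarrow> bool" where
  "alg_ideal sm J \<longleftrightarrow> ring_ideal J \<and> (\<forall>r. \<forall>a\<in>J. sm r a \<in> J)"

definition star_ideal :: "('r::comm_ring_1 \<Rightarrow> 'a::ring \<Rightarrow> 'a) \<Rightarrow> ('a \<Rightarrow> 'a) \<Rightarrow> 'a set \<Rightarrow> bool" where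
  "star_ideal sm star J \<longleftrightarrow> alg_ideal sm J \<and> (\<forall>a\<in>J. star a \<in> J)"

definition star_semiprime :: "('r::comm_ring_1 \<Rightarrow> 'a::ring \<Rightarrow> 'a) \<Rightarrow> ('a \<Rightarrow> 'a) \<Rightarrow> bool" where
  "star_semiprime sm star \<longleftrightarrow>
     (\<forall>J. star_ideal sm star J \<longrightarrow> (\<forall>a\<in>J. \<forall>b\<in>J. a * b = 0) \<longrightarrow> J = {0})"

text \<open>A *-ideal I is *-prime if A/I is *-prime (a non-zero ring whose non-zero *-ideals have
non-zero products).  *-ideals of A/I correspond to *-ideals of A containing I, the zero
ideal of A/I is I itself, and JL/I = 0 iff all products lie in I.\<close>

definition star_prime_ideal :: "('r::comm_ring_1 \<Rightarrow> 'a::ring \<Rightarrow> 'a) \<Rightarrow> ('a \<Rightarrow> 'a) \<Rightarrow> 'a set \<Rightarrow> bool" where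
  "star_prime_ideal sm star I \<longleftrightarrow> star_ideal sm star I \<and> I \<noteq> UNIV \<and>
     (\<forall>J L. star_ideal sm star J \<and> star_ideal sm star L \<and> I \<subseteq> J \<and> I \<subseteq> L \<and>
        (\<forall>a\<in>J. \<forall>b\<in>L. a * b \<in> I) \<longrightarrow> J = I \<or> L = I)"

text \<open>Elements of B = A/I are represented by elements of A, computing modulo I.
An ideal of B is J/I for a ring ideal J \<supseteq> I of A.  J/I is essential in B if it meets
every non-zero ideal of B non-trivially.\<close>

definition quot_essential :: "'a::ring set \<Rightarrow> 'a set \<Rightarrow> bool" where
  "quot_essential I J \<longleftrightarrow> ring_ideal J \<and> I \<subseteq> J \<and>
     (\<forall>L. ring_ideal L \<and> I \<subseteq> L \<and> L \<noteq> I \<longrightarrow> J \<inter> L \<noteq> I)"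

text \<open>A B-bimodule map J/I \<rightarrow> B, represented by a function on J, well defined modulo I.\<close>

definition quot_bimod_map :: "'a::ring set \<Rightarrow> 'a set \<Rightarrow> ('a \<Rightarrow> 'a) \<Rightarrow> bool" where
  "quot_bimod_map I J f \<longleftrightarrow>
     (\<forall>a\<in>J. \<forall>b\<in>J. a - b \<in> I \<longrightarrow> f a - f b \<in> I) \<and>
     (\<forall>a\<in>J. \<forall>b\<in>J. f (a + b) - (f a + f b) \<in> I) \<and>
     (\<forall>r. \<forall>a\<in>J. f (r * a) - r * f a \<in> I \<and> f (a * r) - f a * r \<in> I)"

text \<open>Elements of the extended centroid C of the semiprime ring B are (classes of) bimodule
maps from essential ideals; any finitely many of them can be represented on a common
essential ideal J.  For c_i \<in> C represented by f_i on J and a \<in> J one has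
(c_i x^i) a = f_i (x^i a) in the symmetric ring of quotients Q_s(B), and q \<in> Q_s(B) vanishes
iff q J = 0.  Hence x + I satisfies a monic polynomial of degree n over C iff:\<close>

definition alg_of_degree :: "'a::ring set \<Rightarrow> 'a \<Rightarrow> nat \<Rightarrow> bool" where
  "alg_of_degree I x n \<longleftrightarrow>
     (\<exists>J fs. quot_essential I J \<and> (\<forall>i<n. quot_bimod_map I J (fs i)) \<and>
        (\<forall>a\<in>J. (((*) x) ^^ n) a + (\<Sum>i<n. fs i ((((*) x) ^^ i) a)) \<in> I))"

definition deg_elem :: "'a::ring set \<Rightarrow> 'a \<Rightarrow> enat" where
  "deg_elem I x = (if \<exists>n. alg_of_degree I x n then enat (LEAST n. alg_of_degree I x n) else \<infinity>)"

definition deg_quot :: "'a::ring set \<Rightarrow> enat" where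
  "deg_quot I = (SUP x. deg_elem I x)"

definition is_deriv :: "('r::comm_ring_1 \<Rightarrow> 'a::ring \<Rightarrow> 'a) \<Rightarrow> ('a \<Rightarrow> 'a) \<Rightarrow> bool" where
  "is_deriv sm d \<longleftrightarrow> (\<forall>a b. d (a + b) = d a + d b) \<and> (\<forall>r a. d (sm r a) = sm r (d a)) \<and>
     (\<forall>a b. d (a * b) = d a * b + a * d b)"

definition SDer :: "('r::comm_ring_1 \<Rightarrow> 'a::ring \<Rightarrow> 'a) \<Rightarrow> ('a \<Rightarrow> 'a) \<Rightarrow> ('a \<Rightarrow> 'a) set" where
  "SDer sm star = {d. is_deriv sm d \<and> (\<forall>x. d (star x) = star (d x))}"

definition skew :: "('a::ring \<Rightarrow> 'a) \<Rightarrow> 'a set" where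
  "skew star = {x. star x = - x}"

definition center :: "'a::ring set" where
  "center = {z. \<forall>a. z * a = a * z}"

definition lie_center_K :: "('a::ring \<Rightarrow> 'a) \<Rightarrow> 'a set" where
  "lie_center_K star = {k \<in> skew star. \<forall>k'\<in>skew star. k * k' - k' * k = 0}"

definition I_KZ :: "('r::comm_ring_1 \<Rightarrow> 'a::ring \<Rightarrow> 'a) \<Rightarrow> ('a \<Rightarrow> 'a) \<Rightarrow> ('a \<Rightarrow> 'a) set" where
  "I_KZ sm star = {d \<in> SDer sm star. \<forall>k\<in>skew star. d k \<in> center}"

definition lie_br :: "('a::ring \<Rightarrow> 'a) \<Rightarrow> ('a \<Rightarrow> 'a) \<Rightarrow> ('a \<Rightarrow> 'a)" where
  "lie_br d e = (\<lambda>x. d (e x) - e (d x))"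

text \<open>The Lie algebra S/N (N an ideal of the Lie algebra S) is strongly non-degenerate:
[d,[d,S]] \<subseteq> N implies d \<in> N.  With N = {0} this is strong non-degeneracy of S.\<close>

definition strongly_nondeg_mod :: "('a::ring \<Rightarrow> 'a) set \<Rightarrow> ('a \<Rightarrow> 'a) set \<Rightarrow> bool" where
  "strongly_nondeg_mod S N \<longleftrightarrow> (\<forall>d\<in>S. (\<forall>e\<in>S. lie_br d (lie_br d e) \<in> N) \<longrightarrow> d \<in> N)"

end

theory Submission
  imports Defs
begin

text \<open>Let \<open>K\<close> be the skew elements and \<open>Z\<close> the center. A *-prime quotient in which the products
\<open>k l\<close> of skew elements commute has degree at most \<open>2\<close>: such products are then central and, for
\<open>z = k\<^sup>2 \<noteq> 0\<close> and \<open>w = k (k h + h k)\<close>, every element \<open>x\<close> with symmetric part \<open>h\<close> satisfies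
\<open>z x\<^sup>2 - w x \<in> Z\<close>. As the *-prime ideals intersect in \<open>0\<close>, the commutators \<open>[k\<^sub>1 k\<^sub>2, k\<^sub>3 k\<^sub>4]\<close>
generate an ideal without annihilator, so an element commuting with all \<open>k l\<close> is central.

If \<open>[d, [d, ad k]]\<close> lies in \<open>I\<^bsub>K,Z\<^esub>\<close> for all \<open>k\<close>, then \<open>[d\<^sup>2 k, K] \<subseteq> Z\<close>, which forces \<open>d\<^sup>2 K \<subseteq> Z\<close>, then
\<open>d\<^sup>2 K = 0\<close>, then \<open>d\<^sup>3 = 0\<close>. Since \<open>d\<^sup>2 x\<close> only depends on the symmetric part of \<open>x\<close>, the product
\<open>d\<^sup>2 x d y\<close> is symmetric and alternating, which gives \<open>d\<^sup>2 x A d\<^sup>2 x = 0\<close> and finally \<open>d = 0\<close>. In particular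
\<open>I\<^bsub>K,Z\<^esub> = 0\<close>, and both parts of the theorem reduce to \<open>d = 0\<close>.\<close>

section \<open>Ideals, algebras with involution, and division by 2 and 3\<close>

lemma ring_idealD:
  assumes "ring_ideal I"
  shows "0 \<in> I" "a \<in> I \<Longrightarrow> b \<in> I \<Longrightarrow> a + b \<in> I" "a \<in> I \<Longrightarrow> - a \<in> I"
    "a \<in> I \<Longrightarrow> b \<in> I \<Longrightarrow> a - b \<in> I" "a \<in> I \<Longrightarrow> r * a \<in> I" "a \<in> I \<Longrightarrow> a * r \<in> I"
proof -
  show "a - b \<in> I" if "a \<in> I" "b \<in> I"
    using that assms unfolding ring_ideal_def by (metis diff_conv_add_uminus)
qed (use assms in \<open>auto simp: ring_ideal_def\<close>)

text \<open>Centrality of the class of \<open>z\<close> in \<open>A/I\<close>, stated on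
  representatives; \<open>I = {0}\<close> gives the center of \<open>A\<close>, so both cases share
  lemmas.\<close>

definition central_mod :: "'a::ring set \<Rightarrow> 'a \<Rightarrow> bool" where
  "central_mod I z \<longleftrightarrow> (\<forall>a. z * a - a * z \<in> I)"

locale star_algebra =
  fixes sm :: "'r::comm_ring_1 \<Rightarrow> 'a::ring \<Rightarrow> 'a" and star :: "'a \<Rightarrow> 'a"
  assumes two: "(2::'r) dvd 1" and three: "(3::'r) dvd 1"
    and alg: "algebra_ax sm" and inv: "involution sm star"
begin

lemma sm_add: "sm r (a + b) = sm r a + sm r b"
  and sm_add_left: "sm (r + s) a = sm r a + sm s a"
  and sm_one: "sm 1 a = a"
  and sm_mult_left: "sm r a * b = sm r (a * b)"
  and sm_mult_right: "a * sm r b = sm r (a * b)"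
  using alg unfolding algebra_ax_def by metis+

lemma star_add: "star (a + b) = star a + star b"
  and star_mult: "star (a * b) = star b * star a"
  and star_star: "star (star a) = a"
  and star_sm: "star (sm r a) = sm r (star a)"
  using inv unfolding involution_def by metis+

lemma star_zero: "star 0 = 0"
  using star_add[of 0 0] by simp

lemma star_minus: "star (- a) = - star a"
  using star_add[of a "- a"] star_zero by (simp add: eq_neg_iff_add_eq_0 add.commute)

lemma star_diff: "star (a - b) = star a - star b"
  using star_add[of a "- b"] star_minus by simp

lemmas star_simps = star_add star_mult star_star star_zero star_minus star_diff

lemma sm_zero: "sm r 0 = 0"
  using sm_add[of r 0 0] by simp

lemma sm_minus: "sm r (- a) = - sm r a"
  using sm_add[of r a "- a"] sm_zero by (simp add: eq_neg_iff_add_eq_0 add.commute)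

lemma sm_diff: "sm r (a - b) = sm r a - sm r b"
  using sm_add[of r a "- b"] sm_minus by simp

definition half :: 'r where "half = (SOME c. 1 = 2 * c)"

lemma half: "2 * half = 1"
  using two someI_ex[of "\<lambda>c. 1 = 2 * c"] unfolding half_def dvd_def by metis

lemma sm_half_double: "sm half (a + a) = a"
proof -
  have "sm half (a + a) = sm (2 * half) a"
    by (simp add: sm_add sm_add_left[symmetric])
  then show ?thesis by (simp add: half sm_one)
qed

lemma sm_third_triple: "\<exists>c. \<forall>a. sm c (a + a + a) = a"
proof -
  obtain c :: 'r where c: "1 = 3 * c" using three unfolding dvd_def by blast
  have "sm c (a + a + a) = a" for a
  proof -
    have "sm c (a + a + a) = sm (c + c + c) a"
      by (simp only: sm_add sm_add_left)
    also have "c + c + c = 3 * c" by simp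
    finally show ?thesis using c by (simp add: sm_one)
  qed
  then show ?thesis by blast
qed

lemma alg_ideal_double_mem:
  assumes "alg_ideal sm I" "a + a \<in> I" shows "a \<in> I"
  using assms sm_half_double unfolding alg_ideal_def by metis

lemma alg_ideal_triple_mem:
  assumes "alg_ideal sm I" "a + a + a \<in> I" shows "a \<in> I"
  using assms sm_third_triple unfolding alg_ideal_def by metis

lemma alg_ideal_zero: "alg_ideal sm {0}"
  by (simp add: alg_ideal_def ring_ideal_def sm_zero)

lemma star_ideal_zero: "star_ideal sm star {0}"
  by (simp add: star_ideal_def alg_ideal_zero star_zero)

lemma double_eq_zero: "a + a = 0 \<Longrightarrow> a = (0::'a)"
  by (metis alg_ideal_double_mem alg_ideal_zero singleton_iff)

lemma triple_eq_zero: "a + a + a = 0 \<Longrightarrow> a = (0::'a)"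
  by (metis alg_ideal_triple_mem alg_ideal_zero singleton_iff)

lemma star_idealD:
  assumes "star_ideal sm star J"
  shows "alg_ideal sm J" "ring_ideal J" "a \<in> J \<Longrightarrow> star a \<in> J" "a \<in> J \<Longrightarrow> sm r a \<in> J"
  using assms by (auto simp: star_ideal_def alg_ideal_def)

text \<open>Closure under negation comes from scalar multiplication by \<open>- 1\<close>.\<close>

lemma alg_idealI:
  assumes "0 \<in> J" "\<And>a b. a \<in> J \<Longrightarrow> b \<in> J \<Longrightarrow> a + b \<in> J"
    "\<And>a r. a \<in> J \<Longrightarrow> r * a \<in> J" "\<And>a r. a \<in> J \<Longrightarrow> a * r \<in> J"
    "\<And>a r. a \<in> J \<Longrightarrow> sm r a \<in> J"
  shows "alg_ideal sm J"
proof -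
  have "- a \<in> J" if "a \<in> J" for a
  proof -
    have "sm 0 a = 0"
      using sm_add_left[of 0 0 a] by simp
    then have "sm (- 1) a = - a"
      using sm_add_left[of 1 "- 1" a] sm_one[of a] by (simp add: eq_neg_iff_add_eq_0 add.commute)
    then show ?thesis using assms(5)[OF that, of "- 1"] by simp
  qed
  then show ?thesis using assms by (auto simp: alg_ideal_def ring_ideal_def)
qed

lemma star_ideal_sum:
  assumes "alg_ideal sm G" "alg_ideal sm H" "\<And>g. g \<in> G \<Longrightarrow> star g \<in> H" "\<And>h. h \<in> H \<Longrightarrow> star h \<in> G"
  shows "star_ideal sm star {g + h | g h. g \<in> G \<and> h \<in> H}"
proof -
  have G: "ring_ideal G" "\<And>a r. a \<in> G \<Longrightarrow> sm r a \<in> G"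
    and H: "ring_ideal H" "\<And>a r. a \<in> H \<Longrightarrow> sm r a \<in> H"
    using assms by (auto simp: alg_ideal_def)
  let ?S = "{g + h | g h. g \<in> G \<and> h \<in> H}"
  have I: "g + h \<in> ?S" if "g \<in> G" "h \<in> H" for g h using that by blast
  have "alg_ideal sm ?S"
  proof (rule alg_idealI)
    show "0 \<in> ?S" using I[OF ring_idealD(1)[OF G(1)] ring_idealD(1)[OF H(1)]] by simp
  next
    fix a b assume "a \<in> ?S" "b \<in> ?S"
    then obtain g h g' h' where ab: "a = g + h" "b = g' + h'"
      and gh: "g \<in> G" "h \<in> H" "g' \<in> G" "h' \<in> H" by blast
    have eq: "a + b = (g + g') + (h + h')" by (simp add: ab)
    show "a + b \<in> ?S" unfolding eq
      by (intro I ring_idealD(2)[OF G(1)] ring_idealD(2)[OF H(1)] gh)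
  next
    fix a r assume "a \<in> ?S"
    then obtain g h where a: "a = g + h" and gh: "g \<in> G" "h \<in> H" by blast
    show "r * a \<in> ?S" unfolding a distrib_left
      by (intro I ring_idealD(5)[OF G(1)] ring_idealD(5)[OF H(1)] gh)
    show "a * r \<in> ?S" unfolding a distrib_right
      by (intro I ring_idealD(6)[OF G(1)] ring_idealD(6)[OF H(1)] gh)
  next
    fix a r assume "a \<in> ?S"
    then obtain g h where a: "a = g + h" and gh: "g \<in> G" "h \<in> H" by blast
    show "sm r a \<in> ?S" unfolding a sm_add
      by (intro I G(2) H(2) gh)
  qed
  moreover have "star a \<in> ?S" if a_in: "a \<in> ?S" for a
  proof -
    obtain g h where a: "a = g + h" and gh: "g \<in> G" "h \<in> H" using a_in by blast
    have eq: "star a = star h + star g" by (simp add: a star_simps)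
    show ?thesis unfolding eq by (intro I assms(3,4) gh)
  qed
  ultimately show ?thesis by (simp add: star_ideal_def)
qed

section \<open>Semiprime and prime \<open>*\<close>-ideals\<close>

text \<open>Semiprimeness of \<open>A/I\<close> with its involution. If \<open>A\<close> is
  *-semiprime, \<open>{0}\<close> satisfies it, and so does every *-prime ideal; one argument thus
  serves \<open>A\<close> and its quotients.\<close>

definition semiprime_over :: "'a set \<Rightarrow> bool" where
  "semiprime_over I \<longleftrightarrow> star_ideal sm star I \<and>
     (\<forall>J. star_ideal sm star J \<and> I \<subseteq> J \<and> (\<forall>a\<in>J. \<forall>b\<in>J. a * b \<in> I) \<longrightarrow> J = I)"

lemma semiprime_over_zero: "star_semiprime sm star \<Longrightarrow> semiprime_over {0}"
  unfolding semiprime_over_def star_semiprime_def singleton_iff using star_ideal_zero by blast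

lemma semiprime_over_prime: "star_prime_ideal sm star I \<Longrightarrow> semiprime_over I"
  unfolding semiprime_over_def star_prime_ideal_def by blast

text \<open>The elements of \<open>J\<close> annihilating \<open>J\<close> modulo \<open>I\<close>
  on both sides form a *-ideal with square in \<open>I\<close>, so they make up \<open>I\<close>. As
  \<open>J^3\<close> lies in \<open>I\<close>, all products from \<open>J\<close> are such
  elements.\<close>

lemma semiprime_over_cube:
  assumes sp: "semiprime_over I" and J: "star_ideal sm star J" "I \<subseteq> J"
    and cube: "\<And>a b c. a \<in> J \<Longrightarrow> b \<in> J \<Longrightarrow> c \<in> J \<Longrightarrow> a * b * c \<in> I"
  shows "J = I"
proof -
  have I: "star_ideal sm star I" using sp by (simp add: semiprime_over_def)
  note RI = ring_idealD[OF star_idealD(2)[OF I]] and RJ = ring_idealD[OF star_idealD(2)[OF J(1)]]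
  let ?E = "{e \<in> J. \<forall>j\<in>J. e * j \<in> I \<and> j * e \<in> I}"
  have "alg_ideal sm ?E"
  proof (rule alg_idealI)
    show "0 \<in> ?E" using RI(1) RJ(1) by simp
    show "a + b \<in> ?E" if "a \<in> ?E" "b \<in> ?E" for a b
      using that RI(2) RJ(2) by (auto simp: distrib_left distrib_right)
    show "r * a \<in> ?E" if "a \<in> ?E" for a r
      using that RI(5) RJ(5,6) by (auto simp: mult.assoc) (metis mult.assoc)
    show "a * r \<in> ?E" if "a \<in> ?E" for a r
      using that RI(6) RJ(5,6) by (auto simp: mult.assoc) (metis mult.assoc)
    show "sm r a \<in> ?E" if "a \<in> ?E" for a r
      using that star_idealD(4)[OF I] star_idealD(4)[OF J(1)]
      by (auto simp: sm_mult_left sm_mult_right)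
  qed
  moreover have "star a \<in> ?E" if "a \<in> ?E" for a
  proof -
    have "star a * j \<in> I \<and> j * star a \<in> I" if "j \<in> J" for j
    proof -
      have "a * star j \<in> I" "star j * a \<in> I"
        using \<open>a \<in> ?E\<close> star_idealD(3)[OF J(1) that] by auto
      then show ?thesis
        using star_idealD(3)[OF I] by (metis star_mult star_star)
    qed
    then show ?thesis using that star_idealD(3)[OF J(1)] by simp
  qed
  ultimately have E: "star_ideal sm star ?E" by (simp add: star_ideal_def)
  have "?E = I"
  proof -
    have "I \<subseteq> ?E" using J(2) RI(5,6) by auto
    moreover have "\<forall>a\<in>?E. \<forall>b\<in>?E. a * b \<in> I" by auto
    ultimately show ?thesis using sp E unfolding semiprime_over_def by blast
  qed
  moreover have "a * b \<in> ?E" if "a \<in> J" "b \<in> J" for a b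
    using cube that RJ(5) by (auto simp: mult.assoc[symmetric])
  ultimately show ?thesis using sp J unfolding semiprime_over_def by blast
qed

text \<open>Let \<open>G\<close> be the ideal generated by \<open>I\<close> and \<open>x\<close>,
  and \<open>H\<close> its image under \<open>star\<close>. Their intersection is a *-ideal with
  cube in \<open>I\<close>, hence equals \<open>I\<close>; so mixed products vanish modulo
  \<open>I\<close>, and the *-ideal \<open>G + H\<close> has its cube in \<open>I\<close>
  too.\<close>

lemma semiprime_overD:
  assumes sp: "semiprime_over I" and x: "\<And>a. x * a * x \<in> I"
  shows "x \<in> I"
proof -
  have I: "star_ideal sm star I" using sp by (simp add: semiprime_over_def)
  note RI = ring_idealD[OF star_idealD(2)[OF I]] and sI = star_idealD(4)[OF I]
  define G where "G = \<Inter>{J. alg_ideal sm J \<and> I \<subseteq> J \<and> x \<in> J}"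
  have aG: "alg_ideal sm G"
    unfolding G_def by (rule alg_idealI) (auto simp: alg_ideal_def ring_ideal_def)
  have rG: "ring_ideal G" and sG: "\<And>r a. a \<in> G \<Longrightarrow> sm r a \<in> G" using aG by (auto simp: alg_ideal_def)
  note RG = ring_idealD[OF rG]
  have IG: "I \<subseteq> G" and xG: "x \<in> G" by (auto simp: G_def)
  have least: "G \<subseteq> J" if "alg_ideal sm J" "I \<subseteq> J" "x \<in> J" for J
    using that by (auto simp: G_def)
  \<comment> \<open>Minimality of \<open>G\<close> extends first the right factor from
    \<open>x\<close> to \<open>G\<close>, then the left one, so that \<open>G A G\<close> lies in
    \<open>I\<close>.\<close>
  have "G \<subseteq> {t. \<forall>a. x * a * t \<in> I}"
  proof (rule least)
    show "alg_ideal sm {t. \<forall>a. x * a * t \<in> I}"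
    proof (rule alg_idealI, goal_cases)
      case (3 a r)
      then have "x * (b * r) * a \<in> I" for b by blast
      then show ?case by (simp add: mult.assoc)
    next
      case (4 a r)
      then have "x * b * a * r \<in> I" for b using RI(6) by blast
      then show ?case by (simp add: mult.assoc)
    qed (use RI sI in \<open>auto simp: distrib_left sm_mult_right\<close>)
  qed (use RI x in auto)
  then have xG_mem: "x * a * g \<in> I" if "g \<in> G" for a g using that by blast
  have "G \<subseteq> {s. \<forall>g\<in>G. \<forall>a. s * a * g \<in> I}"
  proof (rule least)
    show "alg_ideal sm {s. \<forall>g\<in>G. \<forall>a. s * a * g \<in> I}"
    proof (rule alg_idealI, goal_cases)
      case (3 a r)
      then have "r * (a * b * g) \<in> I" if "g \<in> G" for b g using RI(5) that by blast
      then show ?case by (simp add: mult.assoc)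
    next
      case (4 a r)
      then have "a * (r * b) * g \<in> I" if "g \<in> G" for b g using that by blast
      then show ?case by (simp add: mult.assoc)
    qed (use RI sI in \<open>auto simp: distrib_right sm_mult_left\<close>)
  qed (use RI xG_mem in auto)
  then have G3: "a * b * c \<in> I" if "a \<in> G" "c \<in> G" for a b c using that by blast
  define F where "F = {a \<in> G. star a \<in> G}"
  have starI: "star a \<in> I" if "a \<in> I" for a using star_idealD(3)[OF I that] .
  have "alg_ideal sm F"
    unfolding F_def by (rule alg_idealI) (auto simp: star_simps star_sm RG sG)
  then have "star_ideal sm star F"
    by (auto simp: star_ideal_def F_def star_simps)
  then have F: "F = I"
    by (rule semiprime_over_cube[OF sp]) (use IG starI G3 in \<open>auto simp: F_def\<close>)
  let ?H = "{a. star a \<in> G}"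
  let ?E = "{g + h | g h. g \<in> G \<and> h \<in> ?H}"
  have aH: "alg_ideal sm ?H"
    by (rule alg_idealI) (auto simp: star_simps star_sm RG sG)
  have mixed: "g * h \<in> I" "h * g \<in> I" if "g \<in> G" "h \<in> ?H" for g h
    unfolding F[symmetric] F_def using that RG(5,6) by (auto simp: star_simps)
  have H3: "a * b * c \<in> I" if "a \<in> ?H" "c \<in> ?H" for a b c
  proof -
    have "star (a * b * c) \<in> I" using that G3 by (auto simp: star_simps mult.assoc[symmetric])
    then show ?thesis using starI by (metis star_star)
  qed
  have "?E = I"
  proof (rule semiprime_over_cube[OF sp])
    show "star_ideal sm star ?E" by (rule star_ideal_sum[OF aG aH]) (auto simp: star_simps)
    show "I \<subseteq> ?E"
    proof
      fix a assume "a \<in> I"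
      then have "a \<in> G" "0 \<in> ?H" "a = a + 0" using IG RG(1) star_zero by auto
      then show "a \<in> ?E" by blast
    qed
    fix a b c assume "a \<in> ?E" "b \<in> ?E" "c \<in> ?E"
    then obtain g1 h1 g2 h2 g3 h3 where e: "a = g1 + h1" "b = g2 + h2" "c = g3 + h3"
      and m: "g1 \<in> G" "g2 \<in> G" "g3 \<in> G" "h1 \<in> ?H" "h2 \<in> ?H" "h3 \<in> ?H" by blast
    have "g1 * g2 * g3 + g1 * (g2 * h3) + g1 * h2 * g3 + g1 * h2 * h3
        + h1 * g2 * g3 + h1 * g2 * h3 + h1 * (h2 * g3) + h1 * h2 * h3 \<in> I"
      by (intro RI(2) G3[OF m(1,3)] H3[OF m(4,6)] RI(5)[OF mixed(1)] RI(5)[OF mixed(2)]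
          RI(6)[OF mixed(1)] RI(6)[OF mixed(2)] m)
    moreover have "a * b * c = g1 * g2 * g3 + g1 * (g2 * h3) + g1 * h2 * g3 + g1 * h2 * h3
        + h1 * g2 * g3 + h1 * g2 * h3 + h1 * (h2 * g3) + h1 * h2 * h3"
      unfolding e by (simp add: algebra_simps)
    ultimately show "a * b * c \<in> I" by simp
  qed
  moreover have "x \<in> ?E"
  proof -
    have "x = x + 0" "0 \<in> ?H" using RG(1) star_zero by auto
    then show ?thesis using xG by blast
  qed
  ultimately show ?thesis by simp
qed

text \<open>\<open>z a z\<close> agrees with \<open>z z a\<close> modulo \<open>I\<close>, so
  semiprimeness applies.\<close>

lemma central_mod_nilpotent:
  assumes sp: "semiprime_over I" and z: "central_mod I z" "z * z \<in> I"
  shows "z \<in> I"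
proof (rule semiprime_overD[OF sp])
  have I: "ring_ideal I" using sp star_idealD(2) by (auto simp: semiprime_over_def)
  fix a
  have "z * (z * a) - z * (z * a - a * z) \<in> I"
    using z ring_idealD[OF I] by (metis central_mod_def mult.assoc)
  then show "z * a * z \<in> I" by (simp add: algebra_simps)
qed

text \<open>The m-sequence argument for *-ideals: starting from \<open>a\<close>, each term is
  followed by a non-zero product of two elements of the *-ideal it generates. A *-ideal maximal
  among those missing the whole sequence is *-prime.\<close>

lemma star_prime_avoiding:
  assumes ss: "star_semiprime sm star" and a: "a \<noteq> 0"
  obtains I where "star_prime_ideal sm star I" "a \<notin> I"
proof -
  define gen where "gen = (\<lambda>x. \<Inter>{J. star_ideal sm star J \<and> x \<in> J})"
  have gen: "star_ideal sm star (gen x)" "x \<in> gen x" for x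
  proof -
    have "alg_ideal sm (gen x)"
      unfolding gen_def
      by (rule alg_idealI) (auto simp: star_ideal_def alg_ideal_def ring_ideal_def)
    then show "star_ideal sm star (gen x)"
      by (auto simp: star_ideal_def gen_def)
    show "x \<in> gen x" by (simp add: gen_def)
  qed
  have "\<exists>y. y \<noteq> 0 \<and> (\<exists>b\<in>gen x. \<exists>c\<in>gen x. y = b * c)" if "x \<noteq> 0" for x
  proof (rule ccontr)
    assume "\<not> ?thesis"
    then have "gen x = {0}"
      using ss gen(1)[of x] unfolding star_semiprime_def by blast
    then show False using gen(2)[of x] that by simp
  qed
  then have "\<exists>s::nat \<Rightarrow> 'a. \<forall>n. (s n \<noteq> 0 \<and> (n = 0 \<longrightarrow> s n = a)) \<and>
      (\<exists>b\<in>gen (s n). \<exists>c\<in>gen (s n). s (Suc n) = b * c)"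
    by (intro dependent_nat_choice) (use a in auto)
  then obtain s :: "nat \<Rightarrow> 'a" where s: "\<And>n. s n \<noteq> 0" "s 0 = a"
    and step: "\<And>n. \<exists>b\<in>gen (s n). \<exists>c\<in>gen (s n). s (Suc n) = b * c"
    by blast
  have gen_least: "gen x \<subseteq> J" if "star_ideal sm star J" "x \<in> J" for x J
    using that by (auto simp: gen_def)
  have mono: "s (n + k) \<in> J" if "star_ideal sm star J" "s n \<in> J" for n k J
  proof (induction k)
    case (Suc k)
    then have "gen (s (n + k)) \<subseteq> J" using gen_least that by blast
    then show ?case
      using step[of "n + k"] ring_idealD(5)[OF star_idealD(2)[OF that(1)]] by fastforce
  qed (use that in simp)
  define S where "S = {J. star_ideal sm star J \<and> (\<forall>n. s n \<notin> J)}"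
  have "{0} \<in> S" using s star_ideal_zero by (simp add: S_def)
  have "\<exists>M\<in>S. \<forall>X\<in>S. M \<subseteq> X \<longrightarrow> X = M"
  proof (rule subset_Zorn_nonempty)
    show "S \<noteq> {}" using \<open>{0} \<in> S\<close> by blast
    fix C assume C: "C \<noteq> {}" "subset.chain S C"
    then have sub: "\<And>J. J \<in> C \<Longrightarrow> star_ideal sm star J \<and> (\<forall>n. s n \<notin> J)"
      and lin: "\<And>J L. J \<in> C \<Longrightarrow> L \<in> C \<Longrightarrow> J \<subseteq> L \<or> L \<subseteq> J"
      by (auto simp: subset.chain_def S_def)
    note m = ring_idealD[OF star_idealD(2)[OF conjunct1[OF sub]]]
    have "alg_ideal sm (\<Union>C)"
    proof (rule alg_idealI)
      show "0 \<in> \<Union>C" using C(1) m(1) by blast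
      show "x + y \<in> \<Union>C" if xy: "x \<in> \<Union>C" "y \<in> \<Union>C" for x y
      proof -
        obtain J where "J \<in> C" "x \<in> J" "y \<in> J" using xy lin by blast
        then show ?thesis using m(2) by blast
      qed
      show "r * x \<in> \<Union>C" if "x \<in> \<Union>C" for x r using m(5) that by blast
      show "x * r \<in> \<Union>C" if "x \<in> \<Union>C" for x r using m(6) that by blast
      show "sm r x \<in> \<Union>C" if "x \<in> \<Union>C" for x r using star_idealD(4) sub that by blast
    qed
    moreover have "star x \<in> \<Union>C" if "x \<in> \<Union>C" for x
      using star_idealD(3) sub that by blast
    ultimately show "\<Union>C \<in> S" using sub by (auto simp: S_def star_ideal_def)
  qed
  then obtain M where M: "star_ideal sm star M" "\<And>n. s n \<notin> M"
    and max: "\<And>X. X \<in> S \<Longrightarrow> M \<subseteq> X \<Longrightarrow> X = M" by (auto simp: S_def)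
  have "J = M \<or> L = M" if J: "star_ideal sm star J" "M \<subseteq> J" and L: "star_ideal sm star L" "M \<subseteq> L"
    and JL: "\<forall>a\<in>J. \<forall>b\<in>L. a * b \<in> M" for J L
  proof (rule ccontr)
    assume "\<not> ?thesis"
    then have "J \<notin> S" "L \<notin> S" using max J(2) L(2) by blast+
    then obtain m n where "s m \<in> J" "s n \<in> L" using J(1) L(1) unfolding S_def by blast
    \<comment> \<open>Beyond both indices the terms lie in \<open>J\<close> and in \<open>L\<close>,
      and the next term is a product of an element of \<open>J\<close> with one of
      \<open>L\<close>.\<close>
    then have "s (m + n) \<in> J" "s (m + n) \<in> L"
      using mono[OF J(1), of m n] mono[OF L(1), of n m] by (simp_all add: add.commute)
    then have "gen (s (m + n)) \<subseteq> J" "gen (s (m + n)) \<subseteq> L" using gen_least J L by auto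
    then have "s (Suc (m + n)) \<in> M" using step[of "m + n"] JL by fastforce
    then show False using M(2) by blast
  qed
  moreover have "M \<noteq> UNIV" using M(2) by blast
  ultimately have "star_prime_ideal sm star M"
    using M(1) unfolding star_prime_ideal_def by blast
  then show ?thesis using that M(2)[of 0] s(2) by simp
qed

section \<open>Skew elements and central elements modulo an ideal\<close>

abbreviation K :: "'a set" where "K \<equiv> skew star"

lemma skew_iff: "x \<in> K \<longleftrightarrow> star x = - x"
  by (simp add: skew_def)

lemma skew_add: "k \<in> K \<Longrightarrow> l \<in> K \<Longrightarrow> k + l \<in> K"
  and skew_minus: "k \<in> K \<Longrightarrow> - k \<in> K"
  and skew_jordan: "k \<in> K \<Longrightarrow> star h = h \<Longrightarrow> k * h + h * k \<in> K"
  and skew_commutator: "k \<in> K \<Longrightarrow> l \<in> K \<Longrightarrow> k * l - l * k \<in> K"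
  and sym_commutator: "star h = h \<Longrightarrow> star g = g \<Longrightarrow> h * g - g * h \<in> K"
  and skew_triple: "k \<in> K \<Longrightarrow> l \<in> K \<Longrightarrow> k * l * k \<in> K"
  by (simp_all add: skew_iff star_simps algebra_simps)

lemma skew_diff_star: "x - star x \<in> K"
  by (simp add: skew_iff star_simps)

lemma sym_skew_decomp:
  obtains h k where "x = h + k" "star h = h" "k \<in> K"
proof
  show "x = sm half (x + star x) + sm half (x - star x)"
    using sm_half_double[of x] by (simp add: sm_add sm_diff)
  show "star (sm half (x + star x)) = sm half (x + star x)"
    by (simp add: star_sm star_simps add.commute)
  show "sm half (x - star x) \<in> K"
    by (simp add: skew_iff star_sm star_simps sm_minus[symmetric])
qed

text \<open>The additive span of the products of two skew elements is a Lie ideal.\<close>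

lemma skew_product_commutator:
  assumes kl: "k \<in> K" "l \<in> K"
    and add: "\<And>x y. P x \<Longrightarrow> P y \<Longrightarrow> P (x + y)"
    and prod: "\<And>k l. k \<in> K \<Longrightarrow> l \<in> K \<Longrightarrow> P (k * l)"
  shows "P (k * l * x - x * (k * l))"
proof -
  obtain h m where x: "x = h + m" and h: "star h = h" and m: "m \<in> K"
    by (rule sym_skew_decomp)
  \<comment> \<open>For symmetric \<open>h\<close> the Leibniz rule is replaced by Jordan products,
    since \<open>l h + h l\<close> is skew while \<open>[l, h]\<close> is symmetric.\<close>
  have "k * l * x - x * (k * l) =
      k * (l * h + h * l) + (- (k * h + h * k)) * l + (k * (l * m - m * l) + (k * m - m * k) * l)"
    by (simp add: x algebra_simps)
  also have "P \<dots>"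
    by (intro add prod kl skew_jordan skew_commutator skew_minus h m)
  finally show ?thesis .
qed

lemma central_modD: "central_mod I z \<Longrightarrow> z * a - a * z \<in> I"
  by (simp add: central_mod_def)

lemma central_modD': "ring_ideal I \<Longrightarrow> central_mod I z \<Longrightarrow> a * z - z * a \<in> I"
  using ring_idealD(3)[of I "z * a - a * z"] by (simp add: central_mod_def)

lemma central_mod_mem:
  assumes "ring_ideal I" "a \<in> I" shows "central_mod I a"
  using ring_idealD(4,5,6)[OF assms(1)] assms(2) by (simp add: central_mod_def)

lemma central_mod_add:
  assumes I: "ring_ideal I" and ab: "central_mod I a" "central_mod I b"
  shows "central_mod I (a + b)"
  unfolding central_mod_def
proof
  fix x
  have "(a * x - x * a) + (b * x - x * b) \<in> I"
    by (intro ring_idealD(2)[OF I] central_modD ab)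
  then show "(a + b) * x - x * (a + b) \<in> I" by (simp add: algebra_simps)
qed

lemma central_mod_minus:
  assumes I: "ring_ideal I" and a: "central_mod I a"
  shows "central_mod I (- a)"
  using central_modD'[OF assms] by (simp add: central_mod_def)

lemma central_mod_diff:
  assumes I: "ring_ideal I" and ab: "central_mod I a" "central_mod I b"
  shows "central_mod I (a - b)"
  using central_mod_add[OF I ab(1) central_mod_minus[OF I ab(2)]] by simp

lemma central_mod_mult:
  assumes I: "ring_ideal I" and ab: "central_mod I a" "central_mod I b"
  shows "central_mod I (a * b)"
  unfolding central_mod_def
proof
  fix x
  have "a * (b * x - x * b) + (a * x - x * a) * b \<in> I"
    by (intro ring_idealD[OF I] central_modD ab)
  then show "a * b * x - x * (a * b) \<in> I" by (simp add: algebra_simps)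
qed

text \<open>With \<open>d = [v, -]\<close> and \<open>d^2 = 0\<close> modulo \<open>I\<close>,
  expanding \<open>d^2 (x y)\<close> gives \<open>2 d x d y = 0\<close>; replacing \<open>y\<close>
  by \<open>y x\<close> leaves \<open>d x y d x = 0\<close>.\<close>

lemma central_mod_if_double_commutator:
  assumes sp: "semiprime_over I"
    and v: "\<And>x. v * (v * x - x * v) - (v * x - x * v) * v \<in> I"
  shows "central_mod I v"
proof -
  have aI: "alg_ideal sm I" and I: "ring_ideal I"
    using sp star_idealD(1,2) by (auto simp: semiprime_over_def)
  note RI = ring_idealD[OF I]
  define d where "d x = v * x - x * v" for x
  have dd: "d (d x) \<in> I" for x using v by (simp add: d_def)
  have d_mult: "d (x * y) = d x * y + x * d y" for x y
    by (simp add: d_def algebra_simps)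
  have prod: "d x * d y \<in> I" for x y
  proof -
    have "d (d (x * y)) - d (d x) * y - x * d (d y) \<in> I"
      by (intro RI dd)
    then have "d x * d y + d x * d y \<in> I"
      by (simp add: d_def algebra_simps)
    then show ?thesis by (rule alg_ideal_double_mem[OF aI])
  qed
  have "d x \<in> I" for x
  proof (rule semiprime_overD[OF sp])
    fix y
    have "d x * d (y * x) - d x * d y * x \<in> I" by (intro RI prod)
    then show "d x * y * d x \<in> I" by (simp add: d_mult algebra_simps)
  qed
  then show ?thesis by (simp add: d_def central_mod_def)
qed

section \<open>Annihilators and the degree of *-prime quotients\<close>

text \<open>The annihilator of \<open>S\<close> and its own annihilator are *-ideals with product in
  \<open>I\<close>, so one of them is \<open>I\<close>. The second contains \<open>S\<close>, so it
  is the first, to which \<open>y\<close> belongs.\<close>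

lemma star_prime_annihilator:
  assumes P: "star_prime_ideal sm star I"
    and S: "\<And>c. c \<in> S \<Longrightarrow> star c \<in> S" "\<not> S \<subseteq> I"
    and y: "\<And>a c. c \<in> S \<Longrightarrow> y * a * c \<in> I"
  shows "y \<in> I"
proof -
  have I: "star_ideal sm star I" using P by (simp add: star_prime_ideal_def)
  note RI = ring_idealD[OF star_idealD(2)[OF I]] and sI = star_idealD(4)[OF I]
  note sp = semiprime_over_prime[OF P]
  \<comment> \<open>Left and right annihilation agree modulo a semiprime ideal; this makes
    \<open>ann T\<close> closed under \<open>star\<close>.\<close>
  have flip: "n * a * m \<in> I" if "\<And>b. m * b * n \<in> I" for m n a
  proof (rule semiprime_overD[OF sp])
    fix b
    have "n * a * (m * b * n) * a * m \<in> I" by (intro RI(6) RI(5) that)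
    then show "n * a * m * b * (n * a * m) \<in> I" by (simp add: mult.assoc)
  qed
  \<comment> \<open>The middle factor \<open>a\<close> makes \<open>ann T\<close> two-sided for an
    arbitrary set \<open>T\<close>.\<close>
  define ann where "ann T = {n. \<forall>c\<in>T. \<forall>a. n * a * c \<in> I}" for T
  have ann: "star_ideal sm star (ann T)" if T: "\<And>c. c \<in> T \<Longrightarrow> star c \<in> T" for T
  proof -
    have "alg_ideal sm (ann T)"
    proof (rule alg_idealI)
      show "r * n \<in> ann T" if "n \<in> ann T" for n r
        using that RI(5) by (simp add: ann_def mult.assoc)
      show "n * r \<in> ann T" if n: "n \<in> ann T" for n r
      proof -
        have "n * (r * a) * c \<in> I" if "c \<in> T" for a c using n that by (auto simp: ann_def)
        then show ?thesis by (simp add: ann_def mult.assoc)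
      qed
    qed (auto simp: ann_def distrib_right sm_mult_left RI sI)
    moreover have "star n \<in> ann T" if n: "n \<in> ann T" for n
    proof -
      have "star n * a * c \<in> I" if c: "c \<in> T" for a c
      proof -
        have "star c * star a * n \<in> I" using flip n T[OF c] by (auto simp: ann_def)
        then have "star (star c * star a * n) \<in> I" by (rule star_idealD(3)[OF I])
        then show ?thesis by (simp add: star_simps mult.assoc)
      qed
      then show ?thesis by (simp add: ann_def)
    qed
    ultimately show ?thesis by (simp add: star_ideal_def)
  qed
  have N: "star_ideal sm star (ann S)" by (rule ann[OF S(1)])
  have J: "star_ideal sm star (ann (ann S))" by (rule ann[OF star_idealD(3)[OF N]])
  have sub: "T \<subseteq> ann (ann T)" for T using flip by (auto simp: ann_def)
  have "I \<subseteq> ann T" for T by (auto simp: ann_def RI)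
  moreover have "\<forall>a\<in>ann S. \<forall>b\<in>ann (ann S). a * b \<in> I"
  proof (intro ballI)
    fix a b assume a: "a \<in> ann S" and b: "b \<in> ann (ann S)"
    show "a * b \<in> I"
    proof (rule semiprime_overD[OF sp])
      fix x
      have "b * x * a \<in> I" using a b unfolding ann_def by blast
      then have "a * (b * x * a) * b \<in> I" by (rule RI(6)[OF RI(5)])
      then show "a * b * x * (a * b) \<in> I" by (simp add: mult.assoc)
    qed
  qed
  moreover have "ann (ann S) \<noteq> I" using sub[of S] S(2) by blast
  ultimately have "ann S = I"
    using P N J unfolding star_prime_ideal_def by blast
  moreover have "y \<in> ann S" using y by (simp add: ann_def)
  ultimately show ?thesis by simp
qed

text \<open>Centrality turns \<open>z a = 0\<close> into \<open>a A z = 0\<close> modulo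
  \<open>I\<close>, and \<open>star z\<close> agrees with \<open>z\<close> there, so
  \<open>a\<close> annihilates the \<open>star\<close>-closed set
  \<open>{z, star z}\<close>.\<close>

lemma star_prime_regular:
  assumes P: "star_prime_ideal sm star I"
    and z: "z \<notin> I" "z - star z \<in> I" "central_mod I z" and a: "z * a \<in> I"
  shows "a \<in> I"
proof (rule star_prime_annihilator[OF P])
  have rI: "ring_ideal I" using P star_idealD(2) by (simp add: star_prime_ideal_def)
  note RI = ring_idealD[OF rI]
  show "\<not> {z, star z} \<subseteq> I" using z(1) by simp
  show "star c \<in> {z, star z}" if "c \<in> {z, star z}" for c using that star_star by auto
  fix b c assume c: "c \<in> {z, star z}"
  have abz: "a * b * z \<in> I"
  proof -
    have "z * a * b - (z * (a * b) - a * b * z) \<in> I"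
      by (rule RI(4)[OF RI(6)[OF a] central_modD[OF z(3)]])
    then show ?thesis by (simp add: mult.assoc)
  qed
  moreover have "a * b * star z \<in> I"
    using RI(4)[OF abz RI(5)[OF z(2), of "a * b"]] by (simp add: right_diff_distrib)
  ultimately show "a * b * c \<in> I" using c by blast
qed

text \<open>As \<open>z\<close> is regular, \<open>x^2 = (w/z) x + u/z\<close> with
  \<open>u = z x^2 - w x\<close> is an equation over the extended centroid. A fraction
  \<open>c/z\<close> with \<open>c\<close> central is realised as a bimodule map on the essential
  ideal \<open>z A + I\<close>.\<close>

lemma deg_quot_le_two:
  assumes P: "star_prime_ideal sm star I"
    and z: "z \<notin> I" "z - star z \<in> I" "central_mod I z"
    and quad: "\<And>x. \<exists>w. central_mod I w \<and> central_mod I (z * x * x - w * x)"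
  shows "deg_quot I \<le> 2"
proof -
  have rI: "ring_ideal I" using P star_idealD(2) by (simp add: star_prime_ideal_def)
  note RI = ring_idealD[OF rI] and reg = star_prime_regular[OF P z]
  define J where "J = {a. \<exists>b. a - z * b \<in> I}"
  \<comment> \<open>Division by \<open>z\<close>; regularity makes the chosen quotient unique modulo
    \<open>I\<close>.\<close>
  define q where "q a = (SOME b. a - z * b \<in> I)" for a
  have J_I: "a \<in> J" if "a - z * b \<in> I" for a b using that by (auto simp: J_def)
  have q: "a - z * q a \<in> I" if "a \<in> J" for a
    using that unfolding J_def q_def by (auto intro: someI_ex)
  have q_unique: "q a - b \<in> I" if "a \<in> J" "a - z * b \<in> I" for a b
  proof (rule reg)
    have "(a - z * b) - (a - z * q a) \<in> I" by (intro RI that q)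
    then show "z * (q a - b) \<in> I" by (simp add: algebra_simps)
  qed
  have q_left: "r * a - z * (r * q a) \<in> I" if "a \<in> J" for a r
  proof -
    have "r * (a - z * q a) - (z * r - r * z) * q a \<in> I" by (intro RI central_modD z q that)
    then show ?thesis by (simp add: algebra_simps)
  qed
  have q_right: "a * r - z * (q a * r) \<in> I" if "a \<in> J" for a r
    using RI(6)[OF q[OF that], of r] by (simp add: algebra_simps)
  have q_add: "a + b - z * (q a + q b) \<in> I" if "a \<in> J" "b \<in> J" for a b
    using RI(2)[OF q[OF that(1)] q[OF that(2)]] by (simp add: algebra_simps)
  have rJ: "ring_ideal J"
    unfolding ring_ideal_def
  proof (intro conjI ballI allI)
    show "0 \<in> J" by (rule J_I[of _ 0]) (simp add: RI)
    fix a assume a: "a \<in> J"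
    show "a + b \<in> J" if "b \<in> J" for b by (rule J_I[OF q_add[OF a that]])
    show "- a \<in> J" using RI(3)[OF q[OF a]] by (intro J_I[of _ "- q a"]) simp
    show "r * a \<in> J" "a * r \<in> J" for r by (rule J_I[OF q_left[OF a]] J_I[OF q_right[OF a]])+
  qed
  note RJ = ring_idealD[OF rJ]
  \<comment> \<open>Essentiality: if \<open>l\<close> lies in an ideal meeting \<open>J\<close> only
    in \<open>I\<close>, then \<open>z l\<close> is in \<open>I\<close>, and so is
    \<open>l\<close>.\<close>
  have "z * l \<in> J" for l by (rule J_I[of _ l]) (simp add: RI)
  moreover have "I \<subseteq> J" using J_I[of _ 0] by auto
  ultimately have ess: "quot_essential I J"
    unfolding quot_essential_def using rJ reg ring_idealD(5) by blast
  have bimod: "quot_bimod_map I J (\<lambda>a. - (c * q a))" if c: "central_mod I c" for c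
    unfolding quot_bimod_map_def
  proof (intro conjI ballI allI impI)
    fix a r assume a: "a \<in> J"
    { fix b assume b: "b \<in> J" and ab: "a - b \<in> I"
      have "(a - b) + (b - z * q b) \<in> I" by (intro RI ab q b)
      then have "q a - q b \<in> I" by (intro q_unique a) simp
      then have "- (c * (q a - q b)) \<in> I" by (rule RI(3)[OF RI(5)])
      then show "- (c * q a) - - (c * q b) \<in> I" by (simp add: algebra_simps) }
    { fix b assume b: "b \<in> J"
      have "- (c * (q (a + b) - (q a + q b))) \<in> I"
        by (intro RI(3,5) q_unique q_add RJ(2) a b)
      then show "- (c * q (a + b)) - (- (c * q a) + - (c * q b)) \<in> I"
        by (simp add: algebra_simps) }
    have "- (c * (q (r * a) - r * q a)) - (c * r - r * c) * q a \<in> I"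
      by (intro RI(3,4,5,6) q_unique q_left RJ(5) a central_modD c)
    then show "- (c * q (r * a)) - r * - (c * q a) \<in> I" by (simp add: algebra_simps)
    have "- (c * (q (a * r) - q a * r)) \<in> I"
      by (intro RI(3,5) q_unique q_right RJ(6) a)
    then show "- (c * q (a * r)) - - (c * q a) * r \<in> I" by (simp add: algebra_simps)
  qed
  have "alg_of_degree I x 2" for x
  proof -
    obtain w where w: "central_mod I w" and u: "central_mod I (z * x * x - w * x)"
      using quad by blast
    let ?u = "z * x * x - w * x"
    define fs where "fs = (\<lambda>i::nat. if i = 0 then \<lambda>a. - (?u * q a) else (\<lambda>a. - (w * q a)))"
    have "x * (x * a) + (- (?u * q a) - w * q (x * a)) \<in> I" if a: "a \<in> J" for a
    proof -
      have "x * x * (a - z * q a) - w * (q (x * a) - x * q a) - (z * (x * x) - x * x * z) * q a \<in> I"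
        by (intro RI(4,5,6) q_unique q_left RJ(5) a q central_modD z)
      then show ?thesis by (simp add: algebra_simps)
    qed
    then have "\<forall>a\<in>J. (((*) x) ^^ 2) a + (\<Sum>i<2. fs i ((((*) x) ^^ i) a)) \<in> I"
      by (simp add: numeral_2_eq_2 fs_def)
    moreover have "quot_bimod_map I J (fs i)" for i
      using bimod[OF w] bimod[OF u] by (simp add: fs_def)
    ultimately show ?thesis unfolding alg_of_degree_def using ess by blast
  qed
  then have "deg_elem I x \<le> 2" for x
    unfolding deg_elem_def using Least_le[of "alg_of_degree I x" 2]
    by (auto simp: numeral_eq_enat)
  then show ?thesis unfolding deg_quot_def by (intro SUP_least)
qed

text \<open>Otherwise the products \<open>k l\<close> commute modulo \<open>I\<close>; as they span
  a Lie ideal, they are central, and skew elements commute. If some square \<open>k k\<close> is not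
  in \<open>I\<close>, it yields a quadratic equation for every element; if there is none,
  \<open>K\<close> lies in \<open>I\<close> and \<open>A/I\<close> is commutative.\<close>

lemma skew_products_not_commuting:
  assumes P: "star_prime_ideal sm star I" and deg: "deg_quot I > 2"
  shows "\<exists>k1\<in>K. \<exists>k2\<in>K. \<exists>k3\<in>K. \<exists>k4\<in>K. k1 * k2 * (k3 * k4) - k3 * k4 * (k1 * k2) \<notin> I"
proof (rule ccontr)
  assume "\<not> ?thesis"
  then have comm4: "k1 * k2 * (k3 * k4) - k3 * k4 * (k1 * k2) \<in> I"
    if "k1 \<in> K" "k2 \<in> K" "k3 \<in> K" "k4 \<in> K" for k1 k2 k3 k4 using that by blast
  have sI: "star_ideal sm star I" and proper: "I \<noteq> UNIV" using P by (simp_all add: star_prime_ideal_def)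
  note aI = star_idealD(1)[OF sI] and rI = star_idealD(2)[OF sI]
  note RI = ring_idealD[OF rI] and sp = semiprime_over_prime[OF P]
  have prod: "central_mod I (k * l)" if kl: "k \<in> K" "l \<in> K" for k l
  proof (rule central_mod_if_double_commutator[OF sp])
    fix x
    show "k * l * (k * l * x - x * (k * l)) - (k * l * x - x * (k * l)) * (k * l) \<in> I"
    proof (rule skew_product_commutator[OF kl, where P = "\<lambda>y. k * l * y - y * (k * l) \<in> I"])
      fix x y
      assume xy: "k * l * x - x * (k * l) \<in> I" "k * l * y - y * (k * l) \<in> I"
      show "k * l * (x + y) - (x + y) * (k * l) \<in> I"
        using RI(2)[OF xy] by (simp add: algebra_simps)
    qed (rule comm4[OF kl])
  qed
  \<comment> \<open>\<open>c = [k, l]\<close> is central, and \<open>c l = [k l, l]\<close> vanishes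
    because \<open>k l\<close> is central; hence \<open>c^2 = 0\<close>.\<close>
  have comm: "k * l - l * k \<in> I" if kl: "k \<in> K" "l \<in> K" for k l
  proof (rule central_mod_nilpotent[OF sp])
    let ?c = "k * l - l * k"
    show c: "central_mod I ?c" by (intro central_mod_diff rI prod kl)
    have cl: "?c * l \<in> I" using central_modD[OF prod[OF kl], of l] by (simp add: algebra_simps)
    have "(?c * k - k * ?c) * l + k * (?c * l) - ?c * l * k \<in> I"
      by (intro RI central_modD c cl)
    then show "?c * ?c \<in> I" by (simp add: algebra_simps)
  qed
  have "deg_quot I \<le> 2"
  proof (cases "\<exists>k\<in>K. k * k \<notin> I")
    case True
    then obtain k where k: "k \<in> K" and z_notin: "k * k \<notin> I" by blast
    define z where "z = k * k"
    have z: "z \<notin> I" "z - star z \<in> I" "central_mod I z"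
      using k z_notin prod RI(1) by (simp_all add: z_def skew_iff star_simps)
    show ?thesis
    proof (rule deg_quot_le_two[OF P z])
      fix x
      obtain h m where x: "x = h + m" and h: "star h = h" and m: "m \<in> K" by (rule sym_skew_decomp)
      \<comment> \<open>Formally \<open>w/z\<close> is the scalar by which
        \<open>l \<mapsto> h l + l h\<close> acts on \<open>K\<close>; its value is read off at
        \<open>l = k\<close>.\<close>
      define w where "w = k * (k * h + h * k)"
      have w: "central_mod I w" unfolding w_def by (intro prod k skew_jordan h)
      have T: "z * (h * l + l * h) - w * l \<in> I" if l: "l \<in> K" for l
      proof (rule star_prime_regular[OF P z])
        have "z * (h * (l * k) - l * k * h) * k + z * (z * (h * l) - h * l * z)
            + z * (z * l - l * z) * h - z * (w * l - l * w) \<in> I"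
          by (intro RI(2,4,5,6) central_modD central_modD'[OF rI] prod z w l k)
        then show "z * (z * (h * l + l * h) - w * l) \<in> I"
          by (simp add: z_def w_def algebra_simps)
      qed
      \<comment> \<open>For symmetric \<open>g\<close> the commutator \<open>[h, g]\<close> is skew,
        so \<open>T\<close> applies to it; for skew \<open>l\<close> the commutator of
        \<open>h\<close> with the relation \<open>T\<close> is used.\<close>
      have "(z * h * h - w * h) * y - y * (z * h * h - w * h) \<in> I" for y
      proof -
        obtain g l where y: "y = g + l" and g: "star g = g" and l: "l \<in> K" by (rule sym_skew_decomp)
        let ?t = "z * (h * l + l * h) - w * l" and ?c = "h * g - g * h"
        have "((z * g - g * z) * h * h - (w * g - g * w) * h + (z * (h * ?c + ?c * h) - w * ?c))
            + ((z * l - l * z) * h * h - (w * l - l * w) * h + (h * ?t - ?t * h)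
              + (z * h - h * z) * (h * l + l * h) - (w * h - h * w) * l) \<in> I"
          by (intro RI(2,4) RI(5)[OF T] RI(6)[OF T] RI(6)[OF central_modD[OF z(3)]] RI(6)[OF central_modD[OF w]]
              RI(6)[OF RI(6)[OF central_modD[OF z(3)]]] T sym_commutator h g l)
        then show ?thesis by (simp add: y algebra_simps)
      qed
      then have "central_mod I (z * h * h - w * h)" by (simp add: central_mod_def)
      then have "central_mod I ((z * h * h - w * h) + (z * (h * m + m * h) - w * m) + z * (m * m))"
        by (intro central_mod_add central_mod_mult central_mod_mem[OF rI T] rI prod m z(3))
      then have "central_mod I (z * x * x - w * x)" by (simp add: x algebra_simps)
      then show "\<exists>w. central_mod I w \<and> central_mod I (z * x * x - w * x)" using w by blast
    qed
  next
    case False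
    then have sq: "k * k \<in> I" if "k \<in> K" for k using that by blast
    have kl: "k * l \<in> I" if k: "k \<in> K" and l: "l \<in> K" for k l
    proof (rule alg_ideal_double_mem[OF aI])
      have "(k + l) * (k + l) - k * k - l * l + (k * l - l * k) \<in> I"
        by (intro RI(2,4) sq comm skew_add k l)
      then show "k * l + k * l \<in> I" by (simp add: algebra_simps)
    qed
    \<comment> \<open>For symmetric \<open>h\<close>, \<open>k (k h + h k)\<close> is a product of
      two skew elements, so \<open>k h k\<close> lies in \<open>I\<close>.\<close>
    have KI: "k \<in> I" if k: "k \<in> K" for k
    proof (rule semiprime_overD[OF sp])
      fix x
      obtain h m where x: "x = h + m" and h: "star h = h" and m: "m \<in> K" by (rule sym_skew_decomp)
      have "k * (k * h + h * k) - k * k * h + k * m * k \<in> I"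
        by (intro RI(2,4) kl skew_jordan RI(6)[OF kl] k h m)
      then show "k * x * k \<in> I" by (simp add: x algebra_simps)
    qed
    have central: "central_mod I x" for x
    proof -
      obtain h m where x: "x = h + m" and h: "star h = h" and m: "m \<in> K" by (rule sym_skew_decomp)
      have "h * y - y * h \<in> I" for y
      proof -
        obtain g l where y: "y = g + l" and g: "star g = g" and l: "l \<in> K" by (rule sym_skew_decomp)
        have "(h * g - g * h) + (h * l - l * h) \<in> I"
          by (intro RI(2,4) RI(5)[OF KI] RI(6)[OF KI] KI sym_commutator h g l)
        then show ?thesis by (simp add: y algebra_simps)
      qed
      then have "central_mod I h" by (simp add: central_mod_def)
      then show ?thesis unfolding x by (rule central_mod_add[OF rI _ central_mod_mem[OF rI KI[OF m]]])
    qed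
    \<comment> \<open>\<open>A/I\<close> is commutative, so any \<open>z\<close> outside
      \<open>I\<close> serves, and \<open>w = z x\<close> makes \<open>z x x - w x\<close>
      vanish.\<close>
    obtain z where "z \<notin> I" using proper by blast
    then show ?thesis
    proof (rule deg_quot_le_two[OF P])
      show "z - star z \<in> I" by (rule KI[OF skew_diff_star])
      show "\<exists>w. central_mod I w \<and> central_mod I (z * x * x - w * x)" for x
        by (intro exI[of _ "z * x"]) (simp add: central)
    qed (rule central)
  qed
  then show False using deg by simp
qed

end

locale star_semiprime_algebra = star_algebra sm star
  for sm :: "'r::comm_ring_1 \<Rightarrow> 'a::ring \<Rightarrow> 'a" and star :: "'a \<Rightarrow> 'a" +
  assumes ss: "star_semiprime sm star"
    and deg: "\<And>I. star_prime_ideal sm star I \<Longrightarrow> deg_quot I > 2"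
begin

lemma semiprime: "(\<And>a. x * a * x = 0) \<Longrightarrow> x = (0::'a)"
  using semiprime_overD[OF semiprime_over_zero[OF ss], of x] by simp

section \<open>The center and the skew elements\<close>

lemma center_iff: "z \<in> center \<longleftrightarrow> central_mod {0} z"
  by (simp add: center_def central_mod_def)

lemma center_comm: "z \<in> center \<Longrightarrow> x * z = z * x"
  by (simp add: center_def)

lemma center_left_comm: "z \<in> center \<Longrightarrow> x * (z * y) = z * (x * y)"
  by (metis center_comm mult.assoc)

lemma ring_ideal_zero: "ring_ideal {0::'a}"
  by (simp add: ring_ideal_def)

lemma center_add: "x \<in> center \<Longrightarrow> y \<in> center \<Longrightarrow> x + y \<in> (center :: 'a set)"
  and center_diff: "x \<in> center \<Longrightarrow> y \<in> center \<Longrightarrow> x - y \<in> (center :: 'a set)"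
  and center_mult: "x \<in> center \<Longrightarrow> y \<in> center \<Longrightarrow> x * y \<in> (center :: 'a set)"
  unfolding center_iff
  by (blast intro: central_mod_add central_mod_diff central_mod_mult ring_ideal_zero)+

lemma center_double: "z + z \<in> center \<Longrightarrow> z \<in> (center :: 'a set)"
  unfolding center_def
proof safe
  fix a assume "\<forall>a. (z + z) * a = a * (z + z)"
  then have "(z * a - a * z) + (z * a - a * z) = 0" by (simp add: algebra_simps)
  then have "z * a - a * z = 0" by (rule double_eq_zero)
  then show "z * a = a * z" by simp
qed

lemma center_triple: "z + z + z \<in> center \<Longrightarrow> z \<in> (center :: 'a set)"
  unfolding center_def
proof safe
  fix a assume "\<forall>a. (z + z + z) * a = a * (z + z + z)"
  then have "(z * a - a * z) + (z * a - a * z) + (z * a - a * z) = 0" by (simp add: algebra_simps)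
  then have "z * a - a * z = 0" by (rule triple_eq_zero)
  then show "z * a = a * z" by simp
qed

lemma center_square_zero: "z \<in> center \<Longrightarrow> z * z = 0 \<Longrightarrow> z = (0::'a)"
  using central_mod_nilpotent[OF semiprime_over_zero[OF ss], of z] by (simp add: center_iff)

lemma center_cube_zero:
  assumes z: "z \<in> center" and "z * (z * z) = 0" shows "z = (0::'a)"
proof (rule center_square_zero[OF z], rule center_square_zero)
  show "z * z \<in> center" by (intro center_mult z)
  have "z * z * (z * z) = z * (z * (z * z))" by (simp add: mult.assoc)
  then show "z * z * (z * z) = 0" using assms by simp
qed

text \<open>A non-zero \<open>y\<close> is missed by some *-prime ideal \<open>I\<close>. By the
  degree hypothesis the commutators \<open>[k1 k2, k3 k4]\<close> are not all in \<open>I\<close>;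
  their set is closed under \<open>star\<close>, so only elements of \<open>I\<close> annihilate it
  modulo \<open>I\<close>.\<close>

lemma skew_products_faithful:
  assumes y: "\<And>a k1 k2 k3 k4. k1 \<in> K \<Longrightarrow> k2 \<in> K \<Longrightarrow> k3 \<in> K \<Longrightarrow> k4 \<in> K \<Longrightarrow>
      y * a * (k1 * k2 * (k3 * k4) - k3 * k4 * (k1 * k2)) = 0"
  shows "y = 0"
proof (rule ccontr)
  assume "y \<noteq> 0"
  then obtain I where P: "star_prime_ideal sm star I" and yI: "y \<notin> I"
    by (rule star_prime_avoiding[OF ss])
  have 0: "0 \<in> I" using P by (simp add: star_prime_ideal_def star_ideal_def alg_ideal_def ring_ideal_def)
  let ?S = "{k1 * k2 * (k3 * k4) - k3 * k4 * (k1 * k2) | k1 k2 k3 k4.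
      k1 \<in> K \<and> k2 \<in> K \<and> k3 \<in> K \<and> k4 \<in> K}"
  have "y \<in> I"
  proof (rule star_prime_annihilator[OF P])
    show "\<not> ?S \<subseteq> I" using skew_products_not_commuting[OF P deg[OF P]] by blast
    show "y * a * c \<in> I" if "c \<in> ?S" for a c using that y 0 by auto
    fix c assume "c \<in> ?S"
    then obtain k1 k2 k3 k4 where k: "k1 \<in> K" "k2 \<in> K" "k3 \<in> K" "k4 \<in> K"
      and c: "c = k1 * k2 * (k3 * k4) - k3 * k4 * (k1 * k2)" by blast
    have "star c = k4 * k3 * (k2 * k1) - k2 * k1 * (k4 * k3)"
      using k by (simp add: c star_simps skew_iff)
    then show "star c \<in> ?S" using k by blast
  qed
  then show False using yI by simp
qed

text \<open>\<open>d = [u, -]\<close> kills the Lie ideal spanned by products \<open>k l\<close>.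
  For \<open>c = [v, w]\<close> with such products \<open>v\<close>, \<open>w\<close>, the identity
  \<open>c x = [v, w x] - w [v, x]\<close> puts \<open>c A\<close> into the kernel of
  \<open>d\<close>, so \<open>c d x = 0\<close> and then \<open>c A d x = 0\<close>.\<close>

lemma center_if_commutes_skew_products:
  assumes u: "\<And>k l. k \<in> K \<Longrightarrow> l \<in> K \<Longrightarrow> u * (k * l) = k * l * u"
  shows "u \<in> center"
proof -
  define d where "d x = u * x - x * u" for x
  have d_mult: "d (x * y) = d x * y + x * d y" for x y
    by (simp add: d_def algebra_simps)
  have V: "u * (k * l * x - x * (k * l)) = (k * l * x - x * (k * l)) * u"
    if "k \<in> K" "l \<in> K" for k l x
    by (rule skew_product_commutator[OF that]) (simp_all add: algebra_simps u[unfolded mult.assoc])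
  have "d r = 0" for r
  proof (rule skew_products_faithful)
    fix a k1 k2 k3 k4 assume k: "k1 \<in> K" "k2 \<in> K" "k3 \<in> K" "k4 \<in> K"
    let ?v = "k1 * k2" and ?w = "k3 * k4" and ?c = "k1 * k2 * (k3 * k4) - k3 * k4 * (k1 * k2)"
    have cx: "?c * x = (?v * (?w * x) - ?w * x * ?v) - ?w * (?v * x - x * ?v)" for x
      by (simp add: algebra_simps)
    have "u * (?w * (?v * x - x * ?v)) = ?w * (?v * x - x * ?v) * u" for x
      using u[OF k(3,4)] V[OF k(1,2), of x] by (metis mult.assoc)
    then have "u * (?c * x) = ?c * x * u" for x
      using V[OF k(1,2), of "?w * x"] unfolding cx by (simp only: right_diff_distrib left_diff_distrib)
    moreover have "u * ?c = ?c * u" by (rule V[OF k(1,2)])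
    ultimately have cd: "?c * d x = 0" for x
      by (simp only: d_def right_diff_distrib mult.assoc[symmetric]) simp
    have cad: "?c * b * d r = 0" for b
    proof -
      have "?c * d b * r + ?c * b * d r = 0"
        using cd[of "b * r"] by (simp only: d_mult distrib_left mult.assoc)
      then show ?thesis by (simp only: cd) simp
    qed
    \<comment> \<open>Semiprimeness moves \<open>?c\<close> from the left of \<open>d r\<close> to
      the right.\<close>
    show "d r * a * ?c = 0"
    proof (rule semiprime)
      fix b
      have "d r * a * ?c * b * (d r * a * ?c) = d r * a * (?c * b * d r) * a * ?c"
        by (simp only: mult.assoc)
      then show "d r * a * ?c * b * (d r * a * ?c) = 0" by (simp only: cad) simp
    qed
  qed
  then show ?thesis by (simp add: d_def center_def)
qed

text \<open>By Leibniz \<open>[k1 k2, k3 k4]\<close> is a sum of terms each containing a commutator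
  of two skew elements.\<close>

lemma center_skew_commutators_faithful:
  assumes z: "z \<in> center" and comm: "\<And>k l. k \<in> K \<Longrightarrow> l \<in> K \<Longrightarrow> z * (k * l - l * k) = 0"
  shows "z = 0"
proof (rule skew_products_faithful)
  fix a k1 k2 k3 k4 assume k: "k1 \<in> K" "k2 \<in> K" "k3 \<in> K" "k4 \<in> K"
  have "z * a * (k1 * k2 * (k3 * k4) - k3 * k4 * (k1 * k2)) =
      a * (k1 * (z * (k2 * k3 - k3 * k2)) * k4 + k1 * k3 * (z * (k2 * k4 - k4 * k2))
        + z * (k1 * k3 - k3 * k1) * k4 * k2 + k3 * (z * (k1 * k4 - k4 * k1)) * k2)"
    using center_comm[OF z, of a] center_left_comm[OF z, of a]
      center_left_comm[OF z, of k1] center_left_comm[OF z, of k3]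
    by (simp add: algebra_simps)
  then show "z * a * (k1 * k2 * (k3 * k4) - k3 * k4 * (k1 * k2)) = 0"
    using comm k by simp
qed

lemma center_skew_multiples_faithful:
  assumes z: "z \<in> center" and zk: "\<And>k. k \<in> K \<Longrightarrow> z * k \<in> center"
  shows "z = 0"
proof (rule center_skew_commutators_faithful[OF z])
  fix k l assume "k \<in> K" "l \<in> K"
  then show "z * (k * l - l * k) = 0"
    using center_comm[OF zk, of k l] center_left_comm[OF z, of l k] by (simp add: algebra_simps)
qed

text \<open>For \<open>z = [a, k]\<close> central, \<open>[a, k\<^sup>3] = 3 z k\<^sup>2\<close> is central, and two further commutators
with \<open>a\<close> leave a multiple of \<open>z\<^sup>3\<close>.\<close>

lemma center_if_skew_commutators_central:
  assumes a: "\<And>k. k \<in> K \<Longrightarrow> a * k - k * a \<in> center"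
  shows "a \<in> center"
proof -
  have "a * k - k * a = 0" if k: "k \<in> K" for k
  proof -
    define z where "z = a * k - k * a"
    have z: "z \<in> center" using a[OF k] by (simp add: z_def)
    note zk = center_comm[OF z, of k] center_left_comm[OF z, of k]
    have "a * (k * k * k) - k * k * k * a = z * k * k + k * z * k + k * k * z"
      by (simp add: z_def algebra_simps)
    also have "\<dots> = z * (k * k) + z * (k * k) + z * (k * k)" by (simp add: zk mult.assoc)
    finally have "z * (k * k) + z * (k * k) + z * (k * k) \<in> center"
      using a[OF skew_triple[OF k k]] by simp
    then have zkk: "z * (k * k) \<in> center" by (rule center_triple)
    have "a * (z * (k * k)) - z * (k * k) * a = z * (z * k + k * z)"
      by (simp add: center_left_comm[OF z, of a]) (simp add: z_def algebra_simps)
    then have "z * (z * k) + z * (z * k) = 0"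
      using center_comm[OF zkk, of a] by (simp add: zk algebra_simps)
    then have zzk: "z * (z * k) = 0" by (rule double_eq_zero)
    have "z * (z * z) = a * (z * (z * k)) - z * (z * k) * a"
      by (simp add: center_left_comm[OF z, of a]) (simp add: z_def algebra_simps)
    then have "z * (z * z) = 0" by (simp add: zzk)
    then show ?thesis using center_cube_zero[OF z] by (simp add: z_def)
  qed
  then have ak: "a * k = k * a" if "k \<in> K" for k using that by simp
  show ?thesis
  proof (rule center_if_commutes_skew_products)
    fix k l assume "k \<in> K" "l \<in> K"
    then show "a * (k * l) = k * l * a" by (metis ak mult.assoc)
  qed
qed

section \<open>Derivations commuting with the involution\<close>

lemma SDer_add: "d \<in> SDer sm star \<Longrightarrow> d (x + y) = d x + d y"
  and SDer_mult: "d \<in> SDer sm star \<Longrightarrow> d (x * y) = d x * y + x * d y"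
  and SDer_sm: "d \<in> SDer sm star \<Longrightarrow> d (sm r x) = sm r (d x)"
  and SDer_star: "d \<in> SDer sm star \<Longrightarrow> d (star x) = star (d x)"
  by (auto simp: SDer_def is_deriv_def)

lemma SDer_zero: "d \<in> SDer sm star \<Longrightarrow> d 0 = 0"
  using SDer_add[of d 0 0] by simp

lemma SDer_minus: "d \<in> SDer sm star \<Longrightarrow> d (- x) = - d x"
  using SDer_add[of d x "- x"] SDer_zero[of d] by (simp add: eq_neg_iff_add_eq_0 add.commute)

lemma SDer_diff: "d \<in> SDer sm star \<Longrightarrow> d (x - y) = d x - d y"
  using SDer_add[of d x "- y"] SDer_minus[of d y] by simp

lemmas SDer_simps = SDer_add SDer_mult SDer_zero SDer_minus SDer_diff

lemma SDer_skew: "d \<in> SDer sm star \<Longrightarrow> k \<in> K \<Longrightarrow> d k \<in> K"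
  by (metis SDer_minus SDer_star skew_iff)

lemma SDer_center:
  assumes d: "d \<in> SDer sm star" and z: "z \<in> center" shows "d z \<in> center"
  unfolding center_def
proof safe
  fix a
  have "d (z * a) = d (a * z)" by (simp only: center_comm[OF z, of a])
  then show "d z * a = a * d z"
    using center_comm[OF z, of "d a"] by (simp add: SDer_mult[OF d] algebra_simps)
qed

lemma SDer_ad_skew:
  assumes k: "k \<in> K" shows "(\<lambda>x. k * x - x * k) \<in> SDer sm star"
  using k by (auto simp: SDer_def is_deriv_def sm_diff sm_mult_left sm_mult_right star_simps
      skew_iff algebra_simps)

text \<open>Applied twice, this turns \<open>ad k\<close> into \<open>ad (d (d k))\<close>, so
  conditions on double brackets become conditions on \<open>d (d k)\<close>.\<close>

lemma lie_br_ad: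
  assumes d: "d \<in> SDer sm star"
  shows "lie_br d (\<lambda>x. k * x - x * k) = (\<lambda>x. d k * x - x * d k)"
  by (rule ext) (simp add: lie_br_def SDer_simps[OF d])

lemma SDer_center_mult:
  assumes d: "d \<in> SDer sm star" and z: "z \<in> center" "star z = z"
  shows "(\<lambda>x. z * d x) \<in> SDer sm star"
proof -
  have "z * (x * d y) = x * (z * d y)" for x y by (simp add: center_left_comm[OF z(1)])
  moreover have "star (d x) * z = z * star (d x)" for x by (rule center_comm[OF z(1)])
  ultimately show ?thesis
    by (simp add: SDer_def is_deriv_def SDer_simps[OF d] SDer_sm[OF d] SDer_star[OF d]
        sm_mult_right star_simps z(2) distrib_left mult.assoc)
qed

section \<open>Vanishing criteria for derivations from their values on skew elements\<close>

text \<open>For \<open>z = d k\<close> and \<open>l = [m, n]\<close> one has \<open>d l = 0\<close>,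
  so \<open>d (k l k) = z (l k + k l)\<close> is central. With its derivative this makes
  \<open>z^3 l\<close> central, which forces \<open>z = 0\<close>. Once \<open>d K = 0\<close>,
  every \<open>d y\<close> commutes with skew products and is central; the Jordan products
  \<open>k h + h k\<close> then settle symmetric \<open>h\<close>.\<close>

lemma SDer_zero_if_skew_central:
  assumes d: "d \<in> SDer sm star" and dK: "\<And>k. k \<in> K \<Longrightarrow> d k \<in> center"
  shows "d x = 0"
proof -
  note D = SDer_simps[OF d]
  have dk: "d k = 0" if k: "k \<in> K" for k
  proof -
    define z where "z = d k"
    have z: "z \<in> center" using dK[OF k] by (simp add: z_def)
    have dz: "d z \<in> center" by (rule SDer_center[OF d z])
    have zzl: "z * (z * (z * (m * n - n * m))) \<in> center" if mn: "m \<in> K" "n \<in> K" for m n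
    proof -
      define l where "l = m * n - n * m"
      have l: "l \<in> K" unfolding l_def by (rule skew_commutator[OF mn])
      have dl: "d l = 0"
        using center_comm[OF dK[OF mn(1)], of n] center_comm[OF dK[OF mn(2)], of m]
        by (simp add: l_def D)
      have eq: "d (k * l * k) = z * (l * k + k * l)"
        using center_comm[OF z, of "k * l"] by (simp add: D dl z_def[symmetric] algebra_simps)
      have c: "z * (l * k + k * l) \<in> center"
        using dK[OF skew_triple[OF k l]] by (simp add: eq)
      have "d (z * (l * k + k * l)) = d z * (l * k + k * l) + (z * (z * l) + z * (z * l))"
        using center_comm[OF z, of l] by (simp add: D dl z_def[symmetric] algebra_simps)
      then have c': "d z * (l * k + k * l) + (z * (z * l) + z * (z * l)) \<in> center"
        using SDer_center[OF d c] by simp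
      \<comment> \<open>\<open>z\<close> times the differentiated relation minus \<open>d z\<close>
        times the original one eliminates \<open>l k + k l\<close>.\<close>
      have "z * (d z * (l * k + k * l) + (z * (z * l) + z * (z * l))) - d z * (z * (l * k + k * l))
          = z * (z * (z * l)) + z * (z * (z * l))"
        using center_left_comm[OF dz, of z] by (simp add: algebra_simps)
      moreover have "\<dots> \<in> center"
        unfolding calculation[symmetric] by (intro center_diff center_mult z dz c c')
      ultimately show ?thesis unfolding l_def[symmetric] by (blast intro: center_double)
    qed
    \<comment> \<open>As all \<open>z^3 [m, n]\<close> are central, \<open>z^3 m\<close> has central
      commutators with \<open>K\<close> and is therefore central.\<close>
    have "z * (z * z) = 0"
    proof (rule center_skew_multiples_faithful)
      show "z * (z * z) \<in> center" by (intro center_mult z)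
      fix m assume m: "m \<in> K"
      show "z * (z * z) * m \<in> center"
      proof (rule center_if_skew_commutators_central)
        fix n assume n: "n \<in> K"
        have "z * (z * z) * m * n - n * (z * (z * z) * m) = z * (z * (z * (m * n - n * m)))"
          using center_left_comm[OF z, of n] by (simp add: algebra_simps)
        then show "z * (z * z) * m * n - n * (z * (z * z) * m) \<in> center"
          using zzl[OF m n] by simp
      qed
    qed
    then show ?thesis using center_cube_zero[OF z] by (simp add: z_def)
  qed
  have dx: "d y \<in> center" for y
  proof (rule center_if_commutes_skew_products)
    fix k l assume kl: "k \<in> K" "l \<in> K"
    have "d (k * l * y - y * (k * l)) = 0"
      by (rule skew_product_commutator[OF kl]) (simp_all add: D dk)
    then show "d y * (k * l) = k * l * d y" using kl by (simp add: D dk)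
  qed
  have dh: "d h = 0" if h: "star h = h" for h
  proof (rule center_skew_multiples_faithful[OF dx])
    fix k assume k: "k \<in> K"
    have "d (k * h + h * k) = 0" by (rule dk[OF skew_jordan[OF k h]])
    then have "d h * k + d h * k = 0"
      using center_comm[OF dx, of k h] by (simp add: D dk[OF k])
    then have "d h * k = 0" by (rule double_eq_zero)
    then show "d h * k \<in> center" by (simp add: center_def)
  qed
  obtain h k where "x = h + k" "star h = h" "k \<in> K" by (rule sym_skew_decomp)
  then show ?thesis using dh dk by (simp add: D)
qed

text \<open>The square \<open>p = z^2\<close> is symmetric, so \<open>p K\<close> stays inside
  \<open>K\<close>. Centrality of \<open>d^2 (p k)\<close> gives \<open>A\<close>, whose instance at
  \<open>d k\<close> gives \<open>B\<close>; together they make \<open>(d^2 p)^2 K\<close> central,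
  so \<open>d^2 p = 0\<close>. Then the derivation \<open>x \<mapsto> d p d x\<close> has central
  values on \<open>K\<close> and vanishes.\<close>

lemma SDer_central_skew_zero:
  assumes d: "d \<in> SDer sm star" and ddK: "\<And>k. k \<in> K \<Longrightarrow> d (d k) \<in> center"
    and z: "z \<in> center" "z \<in> K"
  shows "d z = 0"
proof -
  note D = SDer_simps[OF d]
  define p p1 p2 where "p = z * z" and "p1 = d p" and "p2 = d p1"
  have p: "p \<in> center" "star p = p"
    using z by (simp_all add: p_def center_mult star_simps skew_iff)
  have p1: "p1 \<in> center" "star p1 = p1"
    using SDer_center[OF d p(1)] SDer_star[OF d, of p] p(2) by (simp_all add: p1_def)
  have p2: "p2 \<in> center" using SDer_center[OF d p1(1)] by (simp add: p2_def)
  have A: "p2 * k + (p1 * d k + p1 * d k) \<in> center" if k: "k \<in> K" for k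
  proof -
    have "p * k \<in> K" using k p(2) center_comm[OF p(1), of k] by (simp add: skew_iff star_simps)
    then have "d (d (p * k)) - p * d (d k) \<in> center"
      by (intro center_diff center_mult ddK p(1) k)
    then show ?thesis by (simp add: D p1_def[symmetric] p2_def[symmetric] algebra_simps)
  qed
  have B: "p2 * d k \<in> center" if k: "k \<in> K" for k
  proof -
    have "p2 * d k + (p1 * d (d k) + p1 * d (d k)) - (p1 * d (d k) + p1 * d (d k)) \<in> center"
      by (intro center_diff A SDer_skew[OF d] center_add center_mult p1 ddK k)
    then show ?thesis by simp
  qed
  have "p2 * p2 = 0"
  proof (rule center_skew_multiples_faithful)
    show "p2 * p2 \<in> center" by (intro center_mult p2)
    fix k assume k: "k \<in> K"
    have "p2 * (p2 * k + (p1 * d k + p1 * d k)) - (p1 * (p2 * d k) + p1 * (p2 * d k)) \<in> center"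
      by (intro center_diff center_add center_mult A B p1 p2 k)
    then show "p2 * p2 * k \<in> center"
      using center_left_comm[OF p1(1), of p2] by (simp add: algebra_simps)
  qed
  then have "p2 = 0" by (rule center_square_zero[OF p2])
  then have "p1 * d k + p1 * d k \<in> center" if "k \<in> K" for k
    using A[OF that] by simp
  then have "p1 * d k \<in> center" if "k \<in> K" for k
    using that by (blast intro: center_double)
  then have p1d: "p1 * d x = 0" for x
    by (rule SDer_zero_if_skew_central[OF SDer_center_mult[OF d p1]])
  \<comment> \<open>Now \<open>p1 = 2 z e\<close> and \<open>p1 d z = 0\<close> give
    \<open>z e^2 = 0\<close>, so \<open>z e = 0\<close>; differentiating and multiplying by
    \<open>e\<close> yields \<open>e^3 = 0\<close>.\<close>
  define e where "e = d z"
  have e: "e \<in> center" using SDer_center[OF d z(1)] by (simp add: e_def)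
  note ez = center_comm[OF e, of z] center_left_comm[OF e, of z]
  have "p1 = e * z + z * e" by (simp add: p1_def p_def D e_def)
  then have "z * (e * e) + z * (e * e) = 0"
    using p1d[of z] by (simp add: e_def[symmetric] ez[symmetric] algebra_simps)
  then have zee: "z * (e * e) = 0" by (rule double_eq_zero)
  have "z * e = 0"
  proof (rule center_square_zero)
    have "z * e * (z * e) = z * (z * (e * e))" by (simp add: ez mult.assoc)
    then show "z * e * (z * e) = 0" by (simp add: zee)
  qed (intro center_mult z e)
  moreover from this have "e * e + z * d e = 0"
    using D(2)[of z e] D(3) by (simp add: e_def)
  moreover have "e * (e * e + z * d e) = e * (e * e) + z * e * d e"
    by (simp add: ez algebra_simps)
  ultimately have "e * (e * e) = 0" by simp
  then show ?thesis using center_cube_zero[OF e] by (simp add: e_def)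
qed

text \<open>Let \<open>a = d k\<close>; then \<open>z = d a\<close> is central and skew, so
  \<open>d z = 0\<close>. As \<open>z k^2\<close> is skew, \<open>d^3 (z k^2) = 6 z^2 a\<close> is
  central; so \<open>z^2 a\<close> is central and skew, and its derivative \<open>z^3\<close> is
  zero.\<close>

lemma SDer_square_skew_zero:
  assumes d: "d \<in> SDer sm star" and ddK: "\<And>k. k \<in> K \<Longrightarrow> d (d k) \<in> center"
    and k: "k \<in> K"
  shows "d (d k) = 0"
proof -
  note D = SDer_simps[OF d]
  note cancel = SDer_central_skew_zero[OF d ddK]
  define a z where "a = d k" and "z = d a"
  have a: "a \<in> K" and zK: "z \<in> K" using k SDer_skew[OF d] by (simp_all add: a_def z_def)
  have z: "z \<in> center" using ddK[OF k] by (simp add: a_def z_def)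
  have dz: "d z = 0" by (rule cancel[OF _ z zK])
  have "z * (k * k) \<in> K"
    using k zK center_comm[OF z, of "k * k"] by (simp add: skew_iff star_simps)
  then have c: "d (d (d (z * (k * k)))) \<in> center" by (rule SDer_center[OF d ddK])
  have dzx: "d (z * x) = z * d x" for x by (simp add: D dz)
  have da: "d k = a" "d a = z" by (simp_all add: a_def z_def)
  have "d (d (d (k * k))) = z * a + z * a + (z * a + z * a) + (z * a + z * a)"
    using center_comm[OF z, of a] by (simp add: D dz da)
  then have "d (d (d (z * (k * k)))) = z * (z * a) + z * (z * a) + (z * (z * a) + z * (z * a))
      + (z * (z * a) + z * (z * a))"
    by (simp only: dzx distrib_left)
  then have "z * (z * a) \<in> center"
    using c center_triple[of "z * (z * a) + z * (z * a)"] center_double by metis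
  moreover have "z * (z * a) \<in> K"
    using a zK center_comm[OF z, of a] center_left_comm[OF z, of a] center_comm[OF z, of "z * a"]
    by (simp add: skew_iff star_simps mult.assoc)
  ultimately have "d (z * (z * a)) = 0" by (rule cancel[rotated 1])
  then have "z * (z * z) = 0" by (simp add: D dz z_def[symmetric])
  then show ?thesis using center_cube_zero[OF z] by (simp add: a_def z_def)
qed

text \<open>Apply \<open>d^2\<close> to the skew element \<open>k h + h k\<close>, \<open>h\<close>
  symmetric. The relation \<open>E\<close>, its instance at \<open>d k\<close> and its derivative
  show that \<open>u = d^3 h\<close> anticommutes with \<open>K\<close>; so it commutes with
  products \<open>k l\<close>, is central, and vanishes.\<close>

lemma SDer_cube_zero:
  assumes d: "d \<in> SDer sm star" and ddK: "\<And>k. k \<in> K \<Longrightarrow> d (d k) = 0"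
  shows "d (d (d x)) = 0"
proof -
  note D = SDer_simps[OF d]
  have dddh: "d (d (d h)) = 0" if h: "star h = h" for h
  proof -
    define u where "u = d (d (d h))"
    have E: "d k * d h + d k * d h + (d h * d k + d h * d k) + (k * d (d h) + d (d h) * k) = 0"
      if k: "k \<in> K" for k
      using ddK[OF skew_jordan[OF k h]] ddK[OF k] by (simp add: D algebra_simps)
    have E1: "d k * d (d h) + d (d h) * d k = 0" if k: "k \<in> K" for k
      using E[OF SDer_skew[OF d k]] ddK[OF k] by (simp add: D)
    have anti: "k * u = - (u * k)" if k: "k \<in> K" for k
    proof -
      have "d (d k * d h + d k * d h + (d h * d k + d h * d k) + (k * d (d h) + d (d h) * k)) = 0"
        using E[OF k] by (simp add: D)
      then have "(d k * d (d h) + d (d h) * d k) + (d k * d (d h) + d (d h) * d k)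
          + (d k * d (d h) + d (d h) * d k) + (k * u + u * k) = 0"
        using ddK[OF k] by (simp add: D u_def algebra_simps)
      then show ?thesis by (simp add: E1[OF k] eq_neg_iff_add_eq_0)
    qed
    have u: "u \<in> center"
    proof (rule center_if_commutes_skew_products)
      fix k l assume kl: "k \<in> K" "l \<in> K"
      have "k * l * u = - (k * u * l)" by (simp add: anti[OF kl(2)] mult.assoc)
      also have "\<dots> = u * (k * l)" unfolding anti[OF kl(1)] by (simp add: mult.assoc)
      finally show "u * (k * l) = k * l * u" by simp
    qed
    have "u = 0"
    proof (rule center_skew_multiples_faithful[OF u])
      fix k assume "k \<in> K"
      then have "u * k + u * k = 0" using anti center_comm[OF u, of k] by (metis add.right_inverse)
      then have "u * k = 0" by (rule double_eq_zero)
      then show "u * k \<in> center" by (simp add: center_def)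
    qed
    then show ?thesis by (simp add: u_def)
  qed
  obtain h k where "x = h + k" "star h = h" "k \<in> K" by (rule sym_skew_decomp)
  then show ?thesis using dddh ddK by (simp add: D)
qed

lemma SDer_zero_if_square_skew_zero:
  assumes d: "d \<in> SDer sm star" and ddK: "\<And>k. k \<in> K \<Longrightarrow> d (d k) = 0"
  shows "d x = 0"
proof -
  note D = SDer_simps[OF d]
  have ddd: "d (d (d x)) = 0" for x by (rule SDer_cube_zero[OF d ddK])
  \<comment> \<open>Given \<open>d^3 = 0\<close>, \<open>d^3 (x y)\<close> reduces to
    \<open>3 (d^2 x d y + d x d^2 y)\<close>.\<close>
  have swap: "d x * d (d y) = - (d (d x) * d y)" for x y
  proof -
    have "d (d x) * d y + d x * d (d y) + (d (d x) * d y + d x * d (d y))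
        + (d (d x) * d y + d x * d (d y)) = 0"
      using ddd[of "x * y"] by (simp add: D ddd algebra_simps)
    then have "d (d x) * d y + d x * d (d y) = 0" by (rule triple_eq_zero)
    then show ?thesis by (simp add: eq_neg_iff_add_eq_0 add.commute)
  qed
  have dd_dd: "d (d x) * d (d y) = 0" for x y
    using swap[of "d x" y] by (simp add: ddd)
  have dd_star: "d (d (star x)) = d (d x)" for x
    using ddK[OF skew_diff_star[of x]] by (simp add: D)
  have star_dd: "star (d (d x)) = d (d x)" for x
    using dd_star[of x] by (simp add: SDer_star[OF d])
  \<comment> \<open>\<open>d^2 x d y\<close> equals \<open>- d^2 (x d y)\<close>, and values of
    \<open>d^2\<close> are symmetric; computing its image under \<open>star\<close> factor by factor
    gives the sign change.\<close>
  have anti: "d (d x) * d y = - (d (d y) * d x)" for x y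
  proof -
    have "d (d (x * d y)) = d (d x) * d y + (d x * d (d y) + d x * d (d y))"
      by (simp add: D ddd algebra_simps)
    then have "d (d (x * d y)) = - (d (d x) * d y)" by (simp add: swap)
    then have "d (d x) * d y = - d (d (x * d y))" by simp
    then have "star (d (d x) * d y) = d (d x) * d y"
      by (simp add: star_minus star_dd)
    moreover have "star (d (d x) * d y) = d (star y) * d (d x)"
      by (simp add: star_mult star_dd SDer_star[OF d])
    moreover have "d (star y) * d (d x) = - (d (d y) * d x)"
      by (simp add: swap dd_star)
    ultimately show ?thesis by simp
  qed
  have "d (d x) = 0" for x
  proof (rule semiprime)
    fix y
    have "d (d x) * d (d (y * x)) = 0" by (rule dd_dd)
    then have "d (d x) * d (d y) * x + d (d x) * d y * d x
        + (d (d x) * d y * d x + d (d x) * y * d (d x)) = 0"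
      by (simp only: D distrib_left mult.assoc)
    \<comment> \<open>\<open>anti\<close> and \<open>swap\<close> make \<open>d^2 x\<close> commute
      with \<open>d y\<close>, and \<open>anti\<close> at \<open>y = x\<close> kills
      \<open>d^2 x d x\<close>.\<close>
    moreover have "d (d x) * d y * d x = 0"
    proof -
      have "d (d x) * d x + d (d x) * d x = 0" using anti[of x x] by (metis add.right_inverse)
      then have "d (d x) * d x = 0" by (rule double_eq_zero)
      moreover have "d (d x) * d y * d x = d y * (d (d x) * d x)"
        by (simp add: anti[of x y] swap[of y x] mult.assoc[symmetric])
      ultimately show ?thesis by simp
    qed
    ultimately show "d (d x) * y * d (d x) = 0" by (simp add: dd_dd)
  qed
  then have dd: "d (d x) = 0" for x .
  have prod: "d x * d y = 0" for x y
  proof (rule double_eq_zero)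
    show "d x * d y + d x * d y = 0" using dd[of "x * y"] by (simp add: D dd)
  qed
  show ?thesis
  proof (rule semiprime)
    fix y
    have "d x * d (y * x) = 0" by (rule prod)
    then show "d x * y * d x = 0"
      by (simp add: D distrib_left mult.assoc[symmetric] prod)
  qed
qed

text \<open>At \<open>e = ad k\<close> the hypothesis says that \<open>[d^2 k, K]\<close> is
  central; so \<open>d^2 K\<close> is central, then zero, and \<open>d\<close> vanishes.\<close>

lemma SDer_zero_if_quadratic_annihilator:
  assumes d: "d \<in> SDer sm star"
    and ann: "\<And>e. e \<in> SDer sm star \<Longrightarrow> lie_br d (lie_br d e) \<in> I_KZ sm star"
  shows "d = (\<lambda>_. 0)"
proof -
  have "d (d k) \<in> center" if k: "k \<in> K" for k
  proof (rule center_if_skew_commutators_central)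
    fix l assume "l \<in> K"
    then show "d (d k) * l - l * d (d k) \<in> center"
      using ann[OF SDer_ad_skew[OF k]] by (simp add: lie_br_ad[OF d] I_KZ_def)
  qed
  then show ?thesis
    using SDer_zero_if_square_skew_zero[OF d SDer_square_skew_zero[OF d]] by blast
qed

lemma zero_in_I_KZ: "(\<lambda>_. 0) \<in> I_KZ sm star"
  by (simp add: I_KZ_def SDer_def is_deriv_def sm_zero star_zero center_def)

end

theorem theorem2p8:
  fixes sm :: "'r::comm_ring_1 \<Rightarrow> 'a::ring \<Rightarrow> 'a" and star :: "'a \<Rightarrow> 'a"
  assumes "(2::'r) dvd 1" and "(3::'r) dvd 1"
    and "algebra_ax sm" and "involution sm star"
    and "star_semiprime sm star"
    and "\<exists>x y :: 'a. x * y \<noteq> y * x"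
    and "\<forall>I. star_prime_ideal sm star I \<longrightarrow> deg_quot I > 2"
  shows "strongly_nondeg_mod (SDer sm star) (I_KZ sm star) \<and>
         ((\<forall>J. star_ideal sm star J \<and> J \<subseteq> lie_center_K star \<longrightarrow> J = {0})
         \<longrightarrow> strongly_nondeg_mod (SDer sm star) {\<lambda>_. 0})"
proof -
  interpret star_semiprime_algebra sm star
    using assms by unfold_locales auto
  \<comment> \<open>In both parts the double brackets lie in \<open>I_KZ\<close>, which contains
    \<open>0\<close>; the resulting \<open>d = 0\<close> belongs to either ideal.\<close>
  show ?thesis
    unfolding strongly_nondeg_mod_def
    using SDer_zero_if_quadratic_annihilator zero_in_I_KZ by (metis singleton_iff)
qed

end
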